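(* Let $W$ be a Borel set in $\mathbb{R}^n$ (the rejection region of a test), and let $\mathcal{Z}$ be a concentration space of the covariance model $\mathfrak{C}$. Then: 1. If $\mu_0\in\mathfrak{M}_0$ satisfies $$\lambda_{\mu_0+\mathcal{Z}}\big(\operatorname{bd}(W\cup(\mu_0+\mathcal{Z}))\big)=0,\qquad(\mathrm{a})$$ then for every $0<\sigma^2<\infty$ we have $\sup_{\Sigma\in\mathfrak{C}}P_{\mu_0,\sigma^2\Sigma}(W)=1$; in particular, the size of the test equals $1$. [In case $W=\{y\in\mathbb{R}^n:T(y)\ge C\}$ for some Borel-measurable $T:\mathbb{R}^n\to\overline{\mathbb{R}}$ and $0<C<\infty$, a sufficient condition for (a) is that for $\lambda_{\mathcal{Z}}$-almost every $z\in\mathcal{Z}$ the function $T$ satisfies $T(\mu_0+z)>C$ and is lower semicontinuous at $\mu_0+z$.] 2. If $\mu_0\in\mathfrak{M}_0$ satisfies $$\lambda_{\mu_0+\mathcal{Z}}\big(\operatorname{bd}((\mathbb{R}^n\setminus W)\cup(\mu_0+\mathcal{Z}))\big)=0,\qquad(\mathrm{b})$$ then for every $0<\sigma^2<\infty$ $$\inf_{\Sigma\in\mathfrak{C}}P_{\mu_0,\sigma^2\Sigma}(W)=0,\qquad(\mathrm{c})$$ and hence $\inf_{\mu_1\in\mathfrak{M}_1}\inf_{\Sigma\in\mathfrak{C}}P_{\mu_1,\sigma^2\Sigma}(W)=0$ for every $0<\sigma^2<\infty$. In particular, the test is biased (except in the trivial case where its size is zero). [In case $W=\{y\in\mathbb{R}^n:T(y)\ge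 C\}$ for some Borel-measurable $T:\mathbb{R}^n\to\overline{\mathbb{R}}$ and $0<C<\infty$, a sufficient condition for (b) is that for $\lambda_{\mathcal{Z}}$-almost every $z\in\mathcal{Z}$ the function $T$ satisfies $T(\mu_0+z)<C$ and is upper semicontinuous at $\mu_0+z$.] 3. Suppose (c) holds for some $\mu_0\in\mathfrak{M}_0$ and some $0<\sigma^2<\infty$, and assume $W$ is almost invariant under the group $G(\{\mu_0\})$. Then for every $\mu_1\in\mathfrak{M}_1$ we have $\inf_{0<\sigma^2<\infty}\inf_{\Sigma\in\mathfrak{C}}P_{\mu_1,\sigma^2\Sigma}(W)=0$. [In case $W=\{y\in\mathbb{R}^n:T(y)\ge C\}$ for some Borel-measurable $T:\mathbb{R}^n\to\overline{\mathbb{R}}$ and $0<C<\infty$, almost invariance of $W$ under $G(\{\mu_0\})$ follows from almost invariance of $T$ under $G(\{\mu_0\})$.]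
   Context: Framework: $n,k,q$ are integers with $1\le k<n$, $q\ge1$; $X$ is a fixed real $n\times k$ matrix of rank $k$; $R$ is a fixed real $q\times k$ matrix of rank $q$; $r\in\mathbb{R}^q$. $\mathfrak{C}$ (covariance model) is a nonempty set of symmetric positive definite $n\times n$ matrices such that $\sigma^2\in(0,\infty)$ and $\Sigma\in\mathfrak{C}$ are uniquely determined by $\sigma^2\Sigma$. $\mathfrak{M}=\operatorname{span}(X)$, $\mathfrak{M}_0=\{X\beta:\beta\in\mathbb{R}^k,\ R\beta=r\}$, $\mathfrak{M}_1=\mathfrak{M}\setminus\mathfrak{M}_0$. $P_{\mu,\Phi}$ is the Gaussian measure on $\mathbb{R}^n$ with mean $\mu$ and covariance matrix $\Phi$. The testing problem is $H_0:\mu\in\mathfrak{M}_0$ versus $H_1:\mu\in\mathfrak{M}_1$ (in both cases $0<\sigma^2<\infty$, $\Sigma\in\mathfrak{C}$ arbitrary), observation $\sim P_{\mu,\sigma^2\Sigma}$. The size of $W$ is the supremum of $P_{\mu,\sigma^2\Sigma}(W)$ over $H_0$; the test is biased if the infimum of $P_{\mu,\sigma^2\Sigma}(W)$ over $H_1$ is strictly smaller than its size. Concentration space: an $l$-dimensional linear subspace $\mathcal{Z}$ of $\mathbb{R}^n$ with $0\le l<n$ is a concentration space of $\mathfrak{C}$ if there is a sequence $\Sigma_m\in\mathfrak{C}$ with $\Sigma_m\to\bar\Sigma$ and $\operatorname{span}(\bar\Sigma)=\mathcal{Z}$. $\operatorname{bd}(A)$ is the topological boundary of $A$ in $\mathbb{R}^n$.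 For an affine subspace $\mathcal{A}$ of $\mathbb{R}^n$, $\lambda_{\mathcal{A}}$ is Lebesgue measure on $\mathcal{A}$ viewed as a measure on the Borel sets of $\mathbb{R}^n$ (point mass if $\dim\mathcal{A}=0$). $\overline{\mathbb{R}}$ is the extended real line. $G(\{\mu_0\})$ is the group of maps $y\mapsto\alpha(y-\mu_0)+\mu_0$, $\alpha\ne0$ real. A function $S$ on $\mathbb{R}^n$ is almost invariant under a group $G$ of Borel-measurable bijections of $\mathbb{R}^n$ if for each $g\in G$ there is a Borel set $N(g)$ with $\lambda_{\mathbb{R}^n}(N(g))=0$ and $\lambda_{\mathbb{R}^n}(g'^{-1}(N(g)))=0$ for all $g'\in G$ such that $S(g(y))=S(y)$ for all $y\in\mathbb{R}^n\setminus N(g)$; a set is almost invariant if its indicator function is. *)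

theory Defs
  imports "HOL-Probability.Probability"
begin

definition sym_pos_def :: "real^'n^'n \<Rightarrow> bool" where
  "sym_pos_def S \<longleftrightarrow> transpose S = S \<and> (\<forall>x. x \<noteq> 0 \<longrightarrow> 0 < x \<bullet> (S *v x))"

(* Throughout, a real variable s2 stands for the variance parameter sigma^2 itself. *)
definition covariance_model :: "(real^'n^'n) set \<Rightarrow> bool" where
  "covariance_model \<CC> \<longleftrightarrow>
     \<CC> \<noteq> {} \<and> (\<forall>S\<in>\<CC>. sym_pos_def S) \<and>
     (\<forall>s2>0. \<forall>t2>0. \<forall>S\<in>\<CC>. \<forall>S'\<in>\<CC>. s2 *\<^sub>R S = t2 *\<^sub>R S' \<longrightarrow> s2 = t2 \<and> S = S')"

definition mean_space :: "real^'k^'n \<Rightarrow> (real^'n) set" where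
  "mean_space X = span (columns X)"

definition null_means :: "real^'k^'n \<Rightarrow> real^'k^'q \<Rightarrow> real^'q \<Rightarrow> (real^'n) set" where
  "null_means X R r = {X *v \<beta> | \<beta>. R *v \<beta> = r}"

definition alt_means :: "real^'k^'n \<Rightarrow> real^'k^'q \<Rightarrow> real^'q \<Rightarrow> (real^'n) set" where
  "alt_means X R r = mean_space X - null_means X R r"

(* The Gaussian measure with mean \<mu> and covariance matrix \<Phi>, given by its density.
   Only meaningful for symmetric positive definite \<Phi>, which is the only case used. *)
definition gaussian_measure :: "real^'n \<Rightarrow> real^'n^'n \<Rightarrow> (real^'n) measure" where
  "gaussian_measure \<mu> \<Phi> =
     density lborel (\<lambda>y. ennreal (exp (- ((y - \<mu>) \<bullet> (matrix_inv \<Phi> *v (y - \<mu>))) / 2)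
                                  / sqrt ((2 * pi) ^ CARD('n) * det \<Phi>)))"

definition test_size ::
  "real^'k^'n \<Rightarrow> real^'k^'q \<Rightarrow> real^'q \<Rightarrow> (real^'n^'n) set \<Rightarrow> (real^'n) set \<Rightarrow> real" where
  "test_size X R r \<CC> W =
     (SUP (\<mu>, s2, S) \<in> null_means X R r \<times> {0<..} \<times> \<CC>. measure (gaussian_measure \<mu> (s2 *\<^sub>R S)) W)"

definition biased_test ::
  "real^'k^'n \<Rightarrow> real^'k^'q \<Rightarrow> real^'q \<Rightarrow> (real^'n^'n) set \<Rightarrow> (real^'n) set \<Rightarrow> bool" where
  "biased_test X R r \<CC> W \<longleftrightarrow>
     (INF (\<mu>, s2, S) \<in> alt_means X R r \<times> {0<..} \<times> \<CC>. measure (gaussian_measure \<mu> (s2 *\<^sub>R S)) W)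
       < test_size X R r \<CC> W"

definition concentration_space :: "(real^'n^'n) set \<Rightarrow> (real^'n) set \<Rightarrow> bool" where
  "concentration_space \<CC> Z \<longleftrightarrow>
     subspace Z \<and> dim Z < CARD('n) \<and>
     (\<exists>S S0. (\<forall>m. S m \<in> \<CC>) \<and> S \<longlonglongrightarrow> S0 \<and> span (columns S0) = Z)"

definition translate :: "'a::euclidean_space \<Rightarrow> 'a set \<Rightarrow> 'a set" where
  "translate a Z = (\<lambda>z. a + z) ` Z"

definition orthonormal_basis_of :: "'a::euclidean_space set \<Rightarrow> 'a set \<Rightarrow> bool" where
  "orthonormal_basis_of B V \<longleftrightarrow>
     pairwise orthogonal B \<and> (\<forall>b\<in>B. norm b = 1) \<and> span B = V"

(* Lebesgue measure on a (nonempty) affine subspace A, as a Borel measure on the ambient space: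
   the image of product Lebesgue measure under an isometric parametrization of A.
   By invariance of Lebesgue measure under isometries it does not depend on the base point a and
   the orthonormal basis B chosen. If A is a single point, then B = {}, and the empty product
   is a unit mass, so the result is the point mass. *)
definition affine_lebesgue :: "'a::euclidean_space set \<Rightarrow> 'a measure" where
  "affine_lebesgue A =
     (let a = (SOME a. a \<in> A);
          B = (SOME B. orthonormal_basis_of B ((\<lambda>x. x - a) ` A))
      in distr (Pi\<^sub>M B (\<lambda>_. lborel)) borel (\<lambda>f. a + (\<Sum>b\<in>B. f b *\<^sub>R b)))"

definition lsc_at :: "('a::topological_space \<Rightarrow> ereal) \<Rightarrow> 'a \<Rightarrow> bool" where
  "lsc_at f x \<longleftrightarrow> (\<forall>c. c < f x \<longrightarrow> eventually (\<lambda>y. c < f y) (nhds x))"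

definition usc_at :: "('a::topological_space \<Rightarrow> ereal) \<Rightarrow> 'a \<Rightarrow> bool" where
  "usc_at f x \<longleftrightarrow> (\<forall>c. f x < c \<longrightarrow> eventually (\<lambda>y. f y < c) (nhds x))"

definition scale_group :: "'a::euclidean_space \<Rightarrow> ('a \<Rightarrow> 'a) set" where
  "scale_group \<mu> = {(\<lambda>y. \<alpha> *\<^sub>R (y - \<mu>) + \<mu>) | \<alpha>::real. \<alpha> \<noteq> 0}"

definition almost_invariant ::
  "('a::euclidean_space \<Rightarrow> 'a) set \<Rightarrow> ('a \<Rightarrow> 'b) \<Rightarrow> bool" where
  "almost_invariant G S \<longleftrightarrow>
     (\<forall>g\<in>G. \<exists>N\<in>sets borel. emeasure lborel N = 0 \<and>
        (\<forall>g'\<in>G. emeasure lborel (g' -` N) = 0) \<and> (\<forall>y. y \<notin> N \<longrightarrow> S (g y) = S y))"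

definition almost_invariant_set ::
  "('a::euclidean_space \<Rightarrow> 'a) set \<Rightarrow> 'a set \<Rightarrow> bool" where
  "almost_invariant_set G W \<longleftrightarrow> almost_invariant G (indicator W :: 'a \<Rightarrow> real)"

end

theory Submission
  imports Defs
begin

text \<open>
  \<^bold>\<open>Power one and power zero.\<close>  Along a sequence \<open>S m\<close> in the covariance model converging to a singular
  \<open>S0\<close> whose columns span \<open>Z\<close>, the Gaussian measures with mean \<open>\<mu>0\<close> and covariance \<open>\<sigma>\<^sup>2 S m\<close> converge
  weakly to a Gaussian law that lives on \<open>\<mu>0 + Z\<close> and is equivalent to Lebesgue measure there. As the
  approximating measures do not charge \<open>\<mu>0 + Z\<close>, a set \<open>W\<close> may be replaced by \<open>W \<union> (\<mu>0 + Z)\<close>; if the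
  boundary of the latter is null for Lebesgue measure on \<open>\<mu>0 + Z\<close>, weak convergence yields that the
  probability of \<open>W\<close> tends to the limiting mass of \<open>\<mu>0 + Z\<close>, which is one. The same applied to the
  complement of \<open>W\<close> gives probabilities of \<open>W\<close> tending to zero.

  Weak convergence is made concrete by a coupling. With \<open>\<sigma>\<^sup>2\<close> absorbed into \<open>S m\<close>, write
  \<open>S m = A m ** transpose (A m)\<close>
  (\<open>sym_pos_def_factor\<close>); the factors are bounded, so along a subsequence they converge to some \<open>A0\<close> with
  \<open>A0 ** transpose A0 = S0\<close>, and the range of \<open>A0\<close> is \<open>Z\<close> (\<open>factor_subsequence\<close>,
  \<open>range_factor\<close>). With \<open>x\<close> standard Gaussian, \<open>\<mu>0 + A m *v x\<close> has the prescribed law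
  (\<open>gaussian_measure_eq_distr\<close>) and converges pointwise to \<open>\<mu>0 + A0 *v x\<close>. A surjection onto \<open>Z\<close> pulls
  Lebesgue null sets back to null sets (\<open>linear_preimage_AE\<close>), so almost surely the limit point lies in
  the interior of \<open>W \<union> (\<mu>0 + Z)\<close>, and dominated convergence finishes the argument
  (\<open>gaussian_concentration\<close>). The means may vary with \<open>m\<close> as long as they converge to \<open>\<mu>0\<close>; since
  \<open>\<mu>0\<close> is a limit of elements of the alternative, the power over the alternative has infimum zero as well.

  \<^bold>\<open>Scale invariance.\<close>  The dilation \<open>y \<mapsto> \<alpha> (y - \<mu>0) + \<mu>0\<close> maps the Gaussian measure with parameters
  \<open>\<mu>1\<close> and \<open>\<Phi>\<close> to the one with parameters \<open>\<mu>0 + \<alpha> (\<mu>1 - \<mu>0)\<close> and \<open>\<alpha>\<^sup>2 \<Phi>\<close>. If \<open>W\<close> is almost invariant, the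
  power at \<open>\<mu>1\<close> with variance \<open>\<sigma>\<^sup>2 / \<alpha>\<^sup>2\<close> thus equals the power with variance \<open>\<sigma>\<^sup>2\<close> at a mean that tends to
  \<open>\<mu>0\<close> as \<open>\<alpha>\<close> tends to zero (\<open>gaussian_measure_scale_invariant\<close>). By Fatou's lemma, Gaussian probabilities
  depend semicontinuously on the mean (\<open>gaussian_measure_mean_lower_semicontinuous\<close>), so small power at
  \<open>\<mu>0\<close> carries over to \<open>\<mu>1\<close> (\<open>power_zero_at_alternative\<close>).
\<close>

section \<open>Linear changes of variables for Lebesgue measure\<close>

lemma prod_Basis_vec:
  fixes f :: "real^'n \<Rightarrow> 'b::comm_monoid_mult"
  shows "(\<Prod>b\<in>Basis. f b) = (\<Prod>i\<in>UNIV. f (axis i 1))"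
proof -
  have "Basis = (\<lambda>i. axis i (1::real)) ` (UNIV :: 'n set)"
    by (auto simp: Basis_vec_def)
  moreover have "inj (\<lambda>i::'n. axis i (1::real))"
    by (auto simp: inj_on_def axis_eq_axis)
  ultimately show ?thesis by (metis (no_types, lifting) prod.reindex_cong)
qed

lemma axis_mem_Basis: "axis i (1::real) \<in> Basis"
  by (auto simp: Basis_vec_def)

lemma vec_nth_measurable [measurable]:
  "(\<lambda>x::real^'n. x $ i) \<in> borel_measurable borel"
  by (intro borel_measurable_continuous_onI continuous_intros)

lemma nn_integral_lborel_translate:
  fixes f :: "'a::euclidean_space \<Rightarrow> ennreal"
  assumes [measurable]: "f \<in> borel_measurable borel"
  shows "(\<integral>\<^sup>+x. f (c + x) \<partial>lborel) = (\<integral>\<^sup>+x. f x \<partial>lborel)"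
proof -
  have "(\<integral>\<^sup>+x. f x \<partial>lborel) = (\<integral>\<^sup>+x. f x \<partial>(distr lborel borel ((+) c)))"
    by (simp add: lborel_distr_plus)
  also have "\<dots> = (\<integral>\<^sup>+x. f (c + x) \<partial>lborel)"
    by (subst nn_integral_distr) auto
  finally show ?thesis ..
qed

text \<open>
  A shear only translates each line parallel to \<open>axis m 1\<close>, by an amount that is constant on the line.
  Tonelli's theorem applied to such lines would need a splitting of the space into coordinates; instead,
  \<open>average\<close> writes an integral as a weighted integral over all pairs of a point and a translation along
  \<open>axis m 1\<close>, with weight the indicator of the unit slab. In the inner integral over translations the shear is a
  mere translation of the real line.
\<close>

lemma nn_integral_lborel_shear:
  fixes f :: "real^'n \<Rightarrow> ennreal"
  assumes [measurable]: "f \<in> borel_measurable borel" and mn: "m \<noteq> n"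
  shows "(\<integral>\<^sup>+x. f (x + (x$n) *\<^sub>R axis m 1) \<partial>lborel) = (\<integral>\<^sup>+x. f x \<partial>lborel)"
proof -
  have average: "(\<integral>\<^sup>+x. \<integral>\<^sup>+s. indicator {0..1} (x$m) * F (s *\<^sub>R axis m 1 + x) \<partial>lborel \<partial>lborel) = (\<integral>\<^sup>+x. F x \<partial>lborel)"
    if [measurable]: "F \<in> borel_measurable borel" for F :: "real^'n \<Rightarrow> ennreal"
  proof -
    have "(\<integral>\<^sup>+x. \<integral>\<^sup>+s. indicator {0..1} (x$m) * F (s *\<^sub>R axis m 1 + x) \<partial>lborel \<partial>lborel)
        = (\<integral>\<^sup>+s. \<integral>\<^sup>+x. indicator {0..1} (x$m) * F (s *\<^sub>R axis m 1 + x) \<partial>lborel \<partial>(lborel::real measure))"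
      by (rule lborel_pair.Fubini') simp
    also have "\<dots> = (\<integral>\<^sup>+s. \<integral>\<^sup>+x. indicator {0..1} (x$m - s) * F x \<partial>lborel \<partial>(lborel::real measure))"
    proof (rule nn_integral_cong)
      fix s :: real
      show "(\<integral>\<^sup>+x. indicator {0..1} (x$m) * F (s *\<^sub>R axis m 1 + x) \<partial>lborel) = (\<integral>\<^sup>+x. indicator {0..1} (x$m - s) * F x \<partial>lborel)"
        using nn_integral_lborel_translate[of "\<lambda>x. indicator {0..1} (x$m - s) * F x" "s *\<^sub>R axis m 1"] by simp
    qed
    also have "\<dots> = (\<integral>\<^sup>+x. \<integral>\<^sup>+s. indicator {0..1} (x$m - s) * F x \<partial>(lborel::real measure) \<partial>lborel)"
      by (rule lborel_pair.Fubini') simp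
    also have "\<dots> = (\<integral>\<^sup>+x. (\<integral>\<^sup>+s. indicator {x$m-1..x$m} s \<partial>(lborel::real measure)) * F x \<partial>lborel)"
      by (subst nn_integral_multc[symmetric]) (auto intro!: nn_integral_cong simp: indicator_def)
    also have "\<dots> = (\<integral>\<^sup>+x. F x \<partial>lborel)" by simp
    finally show ?thesis .
  qed
  have "(\<integral>\<^sup>+x. f (x + (x$n) *\<^sub>R axis m 1) \<partial>lborel)
      = (\<integral>\<^sup>+x. \<integral>\<^sup>+s. indicator {0..1} (x$m) * f (s *\<^sub>R axis m 1 + x + (x$n) *\<^sub>R axis m 1) \<partial>lborel \<partial>lborel)"
    using mn by (subst average[symmetric]) (auto simp: axis_def)
  also have "\<dots> = (\<integral>\<^sup>+x. \<integral>\<^sup>+s. indicator {0..1} (x$m) * f (s *\<^sub>R axis m 1 + x) \<partial>lborel \<partial>lborel)"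
  proof (rule nn_integral_cong)
    fix x :: "real^'n"
    show "(\<integral>\<^sup>+s. indicator {0..1} (x$m) * f (s *\<^sub>R axis m 1 + x + (x$n) *\<^sub>R axis m 1) \<partial>lborel)
        = (\<integral>\<^sup>+s. indicator {0..1} (x$m) * f (s *\<^sub>R axis m 1 + x) \<partial>lborel)"
      using nn_integral_lborel_translate[of "\<lambda>s. indicator {0..1} (x$m) * f (s *\<^sub>R axis m 1 + x)" "x$n"]
      by (simp add: algebra_simps)
  qed
  also have "\<dots> = (\<integral>\<^sup>+x. f x \<partial>lborel)" by (rule average) simp
  finally show ?thesis .
qed

lemma matrix_vector_mult_measurable [measurable]:
  fixes A :: "real^'n^'m"
  shows "(*v) A \<in> borel_measurable borel"
  by (intro borel_measurable_continuous_onI matrix_vector_mult_linear_continuous_on)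

text \<open>
  The identity is multiplicative in \<open>A\<close>, so it suffices to treat the matrices that generate all matrices:
  diagonal ones, transpositions of coordinates and shears (a matrix with a zero row has determinant
  zero).
\<close>

lemma nn_integral_lborel_linear:
  fixes A :: "real^'n^'n" and f :: "real^'n \<Rightarrow> ennreal"
  assumes "det A \<noteq> 0" and "f \<in> borel_measurable borel"
  shows "(\<integral>\<^sup>+x. f (A *v x) * ennreal \<bar>det A\<bar> \<partial>lborel) = (\<integral>\<^sup>+x. f x \<partial>lborel)"
proof -
  have "\<forall>f \<in> borel_measurable borel. det A \<noteq> 0 \<longrightarrow> (\<integral>\<^sup>+x. f (A *v x) * ennreal \<bar>det A\<bar> \<partial>lborel) = (\<integral>\<^sup>+x. f x \<partial>lborel)"
  proof (induction A rule: induct_matrix_elementary_alt)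
    case (1 A B)
    show ?case
    proof (intro ballI impI)
      fix f :: "real^'n \<Rightarrow> ennreal" assume [measurable]: "f \<in> borel_measurable borel" and d: "det (A ** B) \<noteq> 0"
      have d': "det A \<noteq> 0" "det B \<noteq> 0" using d by (auto simp: det_mul)
      have "(\<integral>\<^sup>+x. f (A ** B *v x) * ennreal \<bar>det (A ** B)\<bar> \<partial>lborel)
          = (\<integral>\<^sup>+x. (f (A *v (B *v x)) * ennreal \<bar>det A\<bar>) * ennreal \<bar>det B\<bar> \<partial>lborel)"
        by (simp add: det_mul abs_mult ennreal_mult mult.assoc matrix_vector_mul_assoc)
      also have "\<dots> = (\<integral>\<^sup>+x. f (A *v x) * ennreal \<bar>det A\<bar> \<partial>lborel)"
        using 1(2) d'(2) by (subst 1(2)[rule_format, of "\<lambda>y. f (A *v y) * ennreal \<bar>det A\<bar>"]) auto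
      also have "\<dots> = (\<integral>\<^sup>+x. f x \<partial>lborel)"
        using 1(1) d'(1) by simp
      finally show "(\<integral>\<^sup>+x. f (A ** B *v x) * ennreal \<bar>det (A ** B)\<bar> \<partial>lborel) = (\<integral>\<^sup>+x. f x \<partial>lborel)" .
    qed
  next
    case (2 A i)
    then show ?case by (simp add: det_zero_row)
  next
    case (3 A)
    show ?case
    proof (intro ballI impI)
      fix f :: "real^'n \<Rightarrow> ennreal" assume [measurable]: "f \<in> borel_measurable borel" and d: "det A \<noteq> 0"
      have det: "det A = (\<Prod>i\<in>UNIV. A$i$i)" by (rule det_diagonal) (rule 3)
      define c :: "real^'n \<Rightarrow> real" where "c b = b \<bullet> (A *v b)" for b
      have c: "c (axis i 1) = A$i$i" for i
        by (simp add: c_def matrix_vector_mult_basis column_def inner_axis')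
      have nz: "c b \<noteq> 0" if "b \<in> Basis" for b
        using that d by (auto simp: Basis_vec_def c det)
      have A: "A *v x = 0 + (\<Sum>j\<in>Basis. (c j * (x \<bullet> j)) *\<^sub>R j)" for x
      proof (subst vec_eq_iff, intro allI)
        fix i
        have "(A *v x) $ i = (\<Sum>j\<in>UNIV. A$i$j * x$j)" by (simp add: matrix_vector_mult_def)
        also have "\<dots> = (\<Sum>j\<in>UNIV. if j = i then A$i$i * x$i else 0)"
          by (rule sum.cong) (auto simp: 3)
        also have "\<dots> = A$i$i * x$i" by simp
        also have "\<dots> = (0 + (\<Sum>j\<in>Basis. (c j * (x \<bullet> j)) *\<^sub>R j)) \<bullet> axis i 1"
          by (subst add_0, subst inner_sum_left_Basis) (auto simp: c inner_axis axis_mem_Basis)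
        finally show "(A *v x) $ i = (0 + (\<Sum>j\<in>Basis. (c j * (x \<bullet> j)) *\<^sub>R j)) $ i"
          by (simp add: inner_axis)
      qed
      have "lborel = density (distr lborel borel ((*v) A)) (\<lambda>_. (\<Prod>j\<in>Basis. \<bar>c j\<bar>))"
        unfolding A[abs_def] by (rule lborel_affine_euclidean) (rule nz)
      also have "(\<Prod>j\<in>Basis. \<bar>c j\<bar>) = \<bar>det A\<bar>"
        by (simp add: prod_Basis_vec c det abs_prod)
      finally have "(\<integral>\<^sup>+x. f x \<partial>lborel) = (\<integral>\<^sup>+x. f x \<partial>density (distr lborel borel ((*v) A)) (\<lambda>_. \<bar>det A\<bar>))"
        by simp
      then show "(\<integral>\<^sup>+x. f (A *v x) * ennreal \<bar>det A\<bar> \<partial>lborel) = (\<integral>\<^sup>+x. f x \<partial>lborel)"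
        by (simp add: nn_integral_density nn_integral_distr mult.commute)
    qed
  next
    case (4 m n)
    let ?\<tau> = "Transposition.transpose m n"
    let ?A = "(\<chi> i j. mat 1 $ i $ ?\<tau> j) :: real^'n^'n"
    have A: "?A *v x = (\<chi> i. x $ ?\<tau> i)" for x
    proof (subst vec_eq_iff, intro allI)
      fix i
      have "(?A *v x) $ i = (\<Sum>j\<in>UNIV. if j = ?\<tau> i then x $ j else 0)"
        unfolding matrix_vector_mult_def vec_lambda_beta
        by (rule sum.cong) (auto simp: mat_def)
      then show "(?A *v x) $ i = (\<chi> i. x $ ?\<tau> i) $ i" by simp
    qed
    have "\<bar>det ?A\<bar> = 1"
      by (simp add: det_permute_columns permutes_swap_id sign_swap_id abs_mult)
    moreover have "lborel = distr lborel borel ((*v) ?A)"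
    proof (rule lborel_eqI)
      fix l u :: "real^'n" assume lu: "\<And>b. b \<in> Basis \<Longrightarrow> l \<bullet> b \<le> u \<bullet> b"
      let ?l = "(\<chi> i. l $ ?\<tau> i)::real^'n" and ?u = "(\<chi> i. u $ ?\<tau> i)::real^'n"
      have "(*v) ?A -` box l u = box ?l ?u"
        by (auto simp: A mem_box_cart) (metis transpose_involutory)+
      moreover have "l $ i \<le> u $ i" for i
        using lu[of "axis i 1"] by (simp add: inner_axis axis_mem_Basis)
      then have "?l \<bullet> b \<le> ?u \<bullet> b" if "b \<in> Basis" for b
        using that by (auto simp: Basis_vec_def inner_axis)
      then have "emeasure lborel (box ?l ?u) = (\<Prod>b\<in>Basis. (?u - ?l) \<bullet> b)"
        by (rule emeasure_lborel_box)
      moreover have "(\<Prod>b\<in>Basis. (?u - ?l) \<bullet> b) = (\<Prod>b\<in>Basis. (u - l) \<bullet> b)"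
        using prod.permute [OF permutes_swap_id, where S=UNIV and g="\<lambda>i. (u - l)$i", of m n]
        by (simp add: prod_Basis_vec inner_axis o_def)
      ultimately show "emeasure (distr lborel borel ((*v) ?A)) (box l u) = (\<Prod>b\<in>Basis. (u - l) \<bullet> b)"
        by (simp add: emeasure_distr)
    qed simp
    then have "(\<integral>\<^sup>+x. f (?A *v x) \<partial>lborel) = (\<integral>\<^sup>+x. f x \<partial>lborel)"
      if "f \<in> borel_measurable borel" for f :: "real^'n \<Rightarrow> ennreal"
      using that nn_integral_distr[of "(*v) ?A" lborel borel f] by simp
    ultimately show ?case by simp
  next
    case (5 m n)
    let ?A = "(\<chi> i j. of_bool (i = m \<and> j = n \<or> i = j)) :: real^'n^'n"
    have A: "?A *v x = x + (x$n) *\<^sub>R axis m 1" for x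
    proof (subst vec_eq_iff, intro allI)
      fix i
      have "(?A *v x) $ i = (\<Sum>j\<in>UNIV. (if j = i then x$j else 0) + (if j = n then (if i = m then x$j else 0) else 0))"
        unfolding matrix_vector_mult_def vec_lambda_beta
        by (rule sum.cong) (use 5 in auto)
      also have "\<dots> = x$i + (if i = m then x$n else 0)"
        by (simp add: sum.distrib)
      finally show "(?A *v x) $ i = (x + (x$n) *\<^sub>R axis m 1) $ i"
        by (simp add: axis_def)
    qed
    have "?A = (\<chi> k. if k = m then row m (mat 1) + 1 *s row n (mat 1) else row k (mat 1))"
      using 5 by (auto simp: vec_eq_iff row_def mat_def)
    then have "det ?A = 1"
      using det_row_operation[OF 5, where c = 1 and A = "mat 1 :: real^'n^'n"] by (simp only: det_I)
    then show ?case
      unfolding A using 5 by (simp add: nn_integral_lborel_shear del: of_bool_or_iff)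
  qed
  then show ?thesis using assms by blast
qed

section \<open>Gaussian measures as linear images of the standard Gaussian\<close>

abbreviation std_gaussian :: "(real^'n) measure" where
  "std_gaussian \<equiv> gaussian_measure 0 (mat 1)"

lemma sets_gaussian_measure [measurable_cong, simp]: "sets (gaussian_measure \<mu> \<Phi>) = sets borel"
  and space_gaussian_measure [simp]: "space (gaussian_measure \<mu> \<Phi>) = UNIV"
  by (simp_all add: gaussian_measure_def)

lemma gaussian_density_measurable [measurable]:
  fixes \<mu> :: "real^'n"
  shows "(\<lambda>y. ennreal (exp (- ((y - \<mu>) \<bullet> (matrix_inv \<Phi> *v (y - \<mu>))) / 2)
                                  / sqrt ((2 * pi) ^ CARD('n) * det \<Phi>))) \<in> borel_measurable borel"
  by measurable

lemma matrix_inv_left: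
  fixes A :: "real^'n^'n"
  assumes "invertible A"
  shows "matrix_inv A ** A = mat 1"
  using someI_ex[OF assms[unfolded invertible_def]] by (simp add: matrix_inv_def)

lemma matrix_inv_mat_1: "matrix_inv (mat 1 :: real^'n^'n) = mat 1"
  using matrix_inv_left[of "mat 1 :: real^'n^'n"] by (simp add: invertible_det_nz)

lemma std_gaussian_density:
  fixes x :: "real^'n"
  shows "exp (- (x \<bullet> x) / 2) / sqrt ((2 * pi) ^ CARD('n)) = (\<Prod>b\<in>Basis. std_normal_density (x \<bullet> b))"
proof -
  have "(\<Prod>b\<in>Basis. std_normal_density (x \<bullet> b)) = (1 / sqrt (2 * pi)) ^ CARD('n) * exp (\<Sum>i\<in>UNIV. - (x$i)\<^sup>2 / 2)"
    by (simp add: prod_Basis_vec inner_axis std_normal_density_def prod.distrib exp_sum prod_dividef power_divide)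
  also have "(\<Sum>i\<in>UNIV. - (x$i)\<^sup>2 / 2) = - (x \<bullet> x) / 2"
    by (simp add: inner_vec_def sum_negf sum_divide_distrib power2_eq_square)
  finally show ?thesis
    by (simp add: real_sqrt_power[symmetric] power_divide power_mult_distrib)
qed

lemma std_gaussian_eq:
  "(std_gaussian :: (real^'n) measure)
     = density lborel (\<lambda>x. ennreal (exp (- (x \<bullet> x) / 2) / sqrt ((2 * pi) ^ CARD('n))))"
  by (simp add: gaussian_measure_def matrix_inv_mat_1)

lemma prob_space_std_gaussian: "prob_space (std_gaussian :: (real^'n) measure)"
proof (rule prob_spaceI)
  have "emeasure (std_gaussian :: (real^'n) measure) UNIV = (\<integral>\<^sup>+x. (\<Prod>b\<in>Basis. ennreal (std_normal_density (x \<bullet> b))) \<partial>(lborel :: (real^'n) measure))"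
    unfolding std_gaussian_eq std_gaussian_density
    by (subst emeasure_density) (simp_all add: prod_ennreal)
  also have "\<dots> = (\<Prod>b\<in>(Basis::(real^'n) set). \<integral>\<^sup>+x. ennreal (std_normal_density x) \<partial>lborel)"
    by (rule nn_integral_lborel_prod) simp_all
  also have "(\<integral>\<^sup>+x. ennreal (std_normal_density x) \<partial>lborel) = 1"
    using prob_space.emeasure_space_1[OF prob_space_normal_density[of 1 0]] by (simp add: emeasure_density)
  finally show "emeasure std_gaussian (space (std_gaussian :: (real^'n) measure)) = 1" by simp
qed

text \<open>
  Substituting \<open>y = \<mu> + A *v x\<close> in the density turns the quadratic form into \<open>x \<bullet> x\<close>, while the
  Jacobian \<open>\<bar>det A\<bar>\<close> cancels against the square root of \<open>det \<Phi> = (det A)\<^sup>2\<close>.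
\<close>

lemma gaussian_measure_eq_distr:
  fixes A :: "real^'n^'n"
  assumes A: "A ** transpose A = \<Phi>" and det: "det A \<noteq> 0"
  shows "gaussian_measure \<mu> \<Phi> = distr std_gaussian borel (\<lambda>x. \<mu> + A *v x)"
proof (rule measure_eqI)
  show "sets (gaussian_measure \<mu> \<Phi>) = sets (distr std_gaussian borel (\<lambda>x. \<mu> + A *v x))" by simp
next
  fix S assume "S \<in> sets (gaussian_measure \<mu> \<Phi>)"
  then have [measurable]: "S \<in> sets borel" by simp
  define \<phi> where "\<phi> y = exp (- ((y - \<mu>) \<bullet> (matrix_inv \<Phi> *v (y - \<mu>))) / 2) / sqrt ((2 * pi) ^ CARD('n) * det \<Phi>)" for y
  have \<phi>_meas [measurable]: "(\<lambda>y. ennreal (\<phi> y)) \<in> borel_measurable borel"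
    unfolding \<phi>_def by measurable
  have det\<Phi>: "det \<Phi> = (det A)\<^sup>2"
    by (simp add: A[symmetric] det_mul power2_eq_square)
  then have "invertible \<Phi>" "invertible A" using det by (simp_all add: invertible_det_nz)
  have "matrix_inv \<Phi> ** \<Phi> = mat 1" using \<open>invertible \<Phi>\<close> by (rule matrix_inv_left)
  have tA: "transpose A ** (matrix_inv \<Phi> ** A) = mat 1"
  proof -
    have "matrix_inv \<Phi> ** A ** transpose A = mat 1"
      using \<open>matrix_inv \<Phi> ** \<Phi> = mat 1\<close> A by (simp add: matrix_mul_assoc[symmetric])
    then show ?thesis by (simp add: matrix_left_right_inverse)
  qed
  have quad: "(A *v x) \<bullet> (matrix_inv \<Phi> *v (A *v x)) = x \<bullet> x" for x
  proof -
    have "(A *v x) \<bullet> (matrix_inv \<Phi> *v (A *v x)) = x \<bullet> (transpose A *v (matrix_inv \<Phi> *v (A *v x)))"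
      by (metis dot_lmul_matrix inner_commute vector_transpose_matrix)
    also have "\<dots> = x \<bullet> x"
      using tA by (simp add: matrix_vector_mul_assoc)
    finally show ?thesis .
  qed
  have \<phi>: "ennreal (\<phi> (\<mu> + A *v x)) * ennreal \<bar>det A\<bar> = ennreal (exp (- (x \<bullet> x) / 2) / sqrt ((2 * pi) ^ CARD('n)))" for x
    using det by (simp add: \<phi>_def quad det\<Phi> real_sqrt_mult ennreal_mult''[symmetric])
  have "emeasure (gaussian_measure \<mu> \<Phi>) S = (\<integral>\<^sup>+y. ennreal (\<phi> y) * indicator S y \<partial>lborel)"
    unfolding gaussian_measure_def \<phi>_def[symmetric] by (rule emeasure_density) simp_all
  also have "\<dots> = (\<integral>\<^sup>+y. ennreal (\<phi> (\<mu> + y)) * indicator S (\<mu> + y) \<partial>lborel)"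
    by (rule nn_integral_lborel_translate[symmetric]) simp
  also have "\<dots> = (\<integral>\<^sup>+x. ennreal (\<phi> (\<mu> + A *v x)) * indicator S (\<mu> + A *v x) * ennreal \<bar>det A\<bar> \<partial>lborel)"
    using nn_integral_lborel_linear[OF det, of "\<lambda>y. ennreal (\<phi> (\<mu> + y)) * indicator S (\<mu> + y)"] by simp
  also have "\<dots> = (\<integral>\<^sup>+x. ennreal (exp (- (x \<bullet> x) / 2) / sqrt ((2 * pi) ^ CARD('n))) * indicator ((\<lambda>x. \<mu> + A *v x) -` S) x \<partial>lborel)"
    unfolding \<phi>[symmetric] by (rule nn_integral_cong) (simp add: indicator_def ac_simps)
  also have "\<dots> = emeasure (distr std_gaussian borel (\<lambda>x. \<mu> + A *v x)) S"
    unfolding std_gaussian_eq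
    using measurable_sets[of "\<lambda>x. \<mu> + A *v x" borel borel S]
    by (subst emeasure_distr, simp, simp, subst emeasure_density) simp_all
  finally show "emeasure (gaussian_measure \<mu> \<Phi>) S = emeasure (distr std_gaussian borel (\<lambda>x. \<mu> + A *v x)) S" .
qed

lemma gaussian_measure_null:
  assumes "N \<in> sets borel" "emeasure lborel N = 0"
  shows "emeasure (gaussian_measure \<mu> \<Phi>) N = 0"
proof -
  have "N \<in> null_sets lborel" using assms by (simp add: null_sets_def)
  then have "AE y in lborel. y \<notin> N" by (rule AE_not_in)
  then have "N \<in> null_sets (gaussian_measure \<mu> \<Phi>)"
    unfolding gaussian_measure_def using assms
    by (subst null_sets_density_iff) auto
  then show ?thesis by (rule null_setsD1)
qed

text \<open>
  The Gram-Schmidt process for the inner product \<open>x \<bullet> (S *v y)\<close> produces a basis orthonormal for it. If \<open>C\<close> has the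
  basis as its rows, then \<open>C ** S ** transpose C = mat 1\<close>, so \<open>S ** transpose C\<close>, the inverse of \<open>C\<close>, is
  a factor. In place of the process, an orthonormal set of maximal cardinality is taken: if it did not span, one
  step of the process would enlarge it.
\<close>

lemma sym_pos_def_factor:
  fixes S :: "real^'n^'n"
  assumes "sym_pos_def S"
  obtains A :: "real^'n^'n" where "A ** transpose A = S" "det A \<noteq> 0"
proof -
  have sym: "x \<bullet> (S *v y) = y \<bullet> (S *v x)" for x y
    using assms by (metis dot_lmul_matrix inner_commute sym_pos_def_def vector_transpose_matrix)
  have pos: "0 < x \<bullet> (S *v x)" if "x \<noteq> 0" for x
    using assms that by (auto simp: sym_pos_def_def)
  define ons where "ons B \<longleftrightarrow> finite B \<and> (\<forall>b\<in>B. \<forall>c\<in>B. b \<bullet> (S *v c) = of_bool (b = c))" for B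
  have coeff: "b \<bullet> (S *v (\<Sum>c\<in>B. u c *\<^sub>R c)) = u b" if "ons B" "b \<in> B" for B b u
  proof -
    have "b \<bullet> (S *v (\<Sum>c\<in>B. u c *\<^sub>R c)) = (\<Sum>c\<in>B. u c * (b \<bullet> (S *v c)))"
      by (simp add: linear_sum[OF matrix_vector_mul_linear] inner_sum_right matrix_vector_mult_scaleR)
    also have "\<dots> = (\<Sum>c\<in>B. if c = b then u b else 0)"
      using that by (intro sum.cong) (auto simp: ons_def)
    finally show ?thesis using that by (simp add: ons_def)
  qed
  have indep: "independent B" if "ons B" for B
  proof (rule independent_if_scalars_zero)
    show "finite B" using that by (simp add: ons_def)
  next
    fix u b assume "(\<Sum>c\<in>B. u c *\<^sub>R c) = 0" "b \<in> B"
    then show "u b = 0" using coeff[OF that, of b u] by simp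
  qed
  have bound: "card B \<le> CARD('n)" if "ons B" for B
    using independent_bound[OF indep[OF that]] by simp
  have "ons {}" by (simp add: ons_def)
  then obtain B where B: "ons B" and max: "\<And>B'. ons B' \<Longrightarrow> card B' \<le> card B"
    using ex_has_greatest_nat[of ons "{}" card "CARD('n) + 1"] bound by (metis less_Suc_eq_le Suc_eq_plus1)
  have "span B = UNIV"
  proof (rule ccontr)
    assume "span B \<noteq> UNIV"
    then obtain v where v: "v \<notin> span B" by auto
    define w where "w = v - (\<Sum>c\<in>B. (c \<bullet> (S *v v)) *\<^sub>R c)"
    have "(\<Sum>c\<in>B. (c \<bullet> (S *v v)) *\<^sub>R c) \<in> span B" by (intro span_sum span_scale span_base)
    then have "w \<noteq> 0" using v by (auto simp: w_def)
    have orth: "b \<bullet> (S *v w) = 0" if "b \<in> B" for b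
      using coeff[OF B that] by (simp add: w_def matrix_vector_mult_diff_distrib inner_diff_right)
    define q where "q = w \<bullet> (S *v w)"
    have "q > 0" unfolding q_def using \<open>w \<noteq> 0\<close> by (rule pos)
    define w' where "w' = (1 / sqrt q) *\<^sub>R w"
    have "w' \<bullet> (S *v w') = 1" using \<open>q > 0\<close>
      by (simp add: w'_def matrix_vector_mult_scaleR q_def[symmetric])
    moreover have orth': "b \<bullet> (S *v w') = 0" "w' \<bullet> (S *v b) = 0" if "b \<in> B" for b
      using orth[OF that] sym[of b w'] by (simp_all add: w'_def matrix_vector_mult_scaleR)
    ultimately have "w' \<notin> B" by force
    have "ons (insert w' B)" using B \<open>w' \<bullet> (S *v w') = 1\<close> orth' \<open>w' \<notin> B\<close>
      by (auto simp: ons_def)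
    from max[OF this] show False using \<open>w' \<notin> B\<close> B by (simp add: ons_def)
  qed
  then have "card B = CARD('n)"
    using indep[OF B] by (metis DIM_cart DIM_real dim_UNIV dim_span_eq_card_independent mult.right_neutral)
  then obtain f where f: "bij_betw f (UNIV :: 'n set) B"
    using B finite_same_card_bij[of "UNIV :: 'n set" B] by (auto simp: ons_def)
  define C :: "real^'n^'n" where "C = (\<chi> i. f i)"
  have row: "row i C = f i" for i by (simp add: C_def row_def vec_eq_iff)
  have "(C ** S ** transpose C) $ i $ j = f i \<bullet> (S *v f j)" for i j
  proof -
    have "(C ** S ** transpose C) $ i $ j = (C ** (S ** transpose C)) $ i $ j"
      by (simp add: matrix_mul_assoc)
    also have "\<dots> = f i \<bullet> (S *v f j)"
      by (simp add: matrix_matrix_mult_def C_def inner_vec_def matrix_vector_mult_def transpose_def)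
    finally show ?thesis .
  qed
  moreover have "f i \<bullet> (S *v f j) = of_bool (i = j)" for i j
    using B f by (auto simp: ons_def bij_betw_def inj_on_def)
  ultimately have CSC: "C ** S ** transpose C = mat 1"
    by (simp add: vec_eq_iff mat_def)
  define A where "A = S ** transpose C"
  have CA: "C ** A = mat 1" using CSC by (simp add: A_def matrix_mul_assoc)
  then have AC: "A ** C = mat 1" by (simp add: matrix_left_right_inverse)
  have "transpose A = C ** S"
    using assms by (simp add: A_def matrix_transpose_mul sym_pos_def_def)
  then have "A ** transpose A = S" using AC by (simp add: matrix_mul_assoc)
  moreover have "det A \<noteq> 0"
    using arg_cong[OF CA, of det] by (auto simp: det_mul)
  ultimately show thesis by (rule that)
qed

section \<open>Lebesgue measure on affine subspaces\<close>

lemma distr_PiM_lborel_translate: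
  fixes c :: "'i \<Rightarrow> real"
  assumes "finite B"
  shows "distr (Pi\<^sub>M B (\<lambda>_. lborel)) (Pi\<^sub>M B (\<lambda>_. lborel)) (\<lambda>t. \<lambda>b\<in>B. c b + t b) = Pi\<^sub>M B (\<lambda>_. lborel)"
proof -
  interpret product_sigma_finite "\<lambda>_::'i. lborel :: real measure" by standard
  show ?thesis
  proof (rule PiM_eqI[OF assms])
    fix A :: "'i \<Rightarrow> real set" assume A: "\<And>i. i \<in> B \<Longrightarrow> A i \<in> sets lborel"
    have A': "(+) (c i) -` A i \<in> sets borel" if "i \<in> B" for i
      using A[OF that] measurable_sets[of "(+) (c i)" borel borel "A i"] by simp
    have "emeasure (distr (Pi\<^sub>M B (\<lambda>_. lborel)) (Pi\<^sub>M B (\<lambda>_. lborel)) (\<lambda>t. \<lambda>b\<in>B. c b + t b)) (Pi\<^sub>E B A)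
        = emeasure (Pi\<^sub>M B (\<lambda>_. lborel)) ((\<lambda>t. \<lambda>b\<in>B. c b + t b) -` Pi\<^sub>E B A \<inter> space (Pi\<^sub>M B (\<lambda>_. lborel)))"
      by (rule emeasure_distr) (auto intro!: measurable_restrict sets_PiM_I_finite assms A)
    also have "(\<lambda>t. \<lambda>b\<in>B. c b + t b) -` Pi\<^sub>E B A \<inter> space (Pi\<^sub>M B (\<lambda>_. lborel)) = (\<Pi>\<^sub>E i\<in>B. (+) (c i) -` A i)"
      by (auto simp: space_PiM PiE_iff)
    also have "emeasure (Pi\<^sub>M B (\<lambda>_. lborel)) (\<Pi>\<^sub>E i\<in>B. (+) (c i) -` A i) = (\<Prod>i\<in>B. emeasure lborel ((+) (c i) -` A i))"
      using A' by (intro emeasure_PiM assms) simp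
    also have "\<dots> = (\<Prod>i\<in>B. emeasure lborel (A i))"
    proof (rule prod.cong)
      fix i assume "i \<in> B"
      then show "emeasure lborel ((+) (c i) -` A i) = emeasure lborel (A i)"
        using A[OF \<open>i \<in> B\<close>] emeasure_distr[of "(+) (c i)" lborel borel "A i"] by (simp add: lborel_distr_plus)
    qed simp
    finally show "emeasure (distr (Pi\<^sub>M B (\<lambda>_. lborel)) (Pi\<^sub>M B (\<lambda>_. lborel)) (\<lambda>t. \<lambda>b\<in>B. c b + t b)) (Pi\<^sub>E B A)
        = (\<Prod>i\<in>B. emeasure lborel (A i))" .
  qed simp
qed

lemma orthonormal_basis_of_finite:
  fixes B :: "'a::euclidean_space set"
  assumes "orthonormal_basis_of B V"
  shows "finite B"
proof -
  have "0 \<notin> B" using assms by (auto simp: orthonormal_basis_of_def)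
  with assms have "independent B"
    by (intro pairwise_orthogonal_independent) (auto simp: orthonormal_basis_of_def)
  then show ?thesis by (rule independent_imp_finite)
qed

lemma orthonormal_basis_of_expansion:
  fixes B :: "'a::euclidean_space set"
  assumes B: "orthonormal_basis_of B V" and "z \<in> V"
  shows "(\<Sum>b\<in>B. (z \<bullet> b) *\<^sub>R b) = z"
proof -
  have fin: "finite B" using B by (rule orthonormal_basis_of_finite)
  have "z \<in> span B" using assms by (simp add: orthonormal_basis_of_def)
  then obtain u where u: "z = (\<Sum>b\<in>B. u b *\<^sub>R b)"
    by (auto simp: span_finite[OF fin])
  have "z \<bullet> b = u b" if "b \<in> B" for b
  proof -
    have "z \<bullet> b = (\<Sum>c\<in>B. u c * (c \<bullet> b))" by (simp add: u inner_sum_left)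
    also have "\<dots> = (\<Sum>c\<in>B. if c = b then u b else 0)"
    proof (rule sum.cong)
      fix c assume "c \<in> B"
      then show "u c * (c \<bullet> b) = (if c = b then u b else 0)"
        using B that
        by (auto simp: orthonormal_basis_of_def pairwise_def orthogonal_def norm_eq_1)
    qed simp
    also have "\<dots> = u b" using fin that by simp
    finally show ?thesis .
  qed
  then show ?thesis by (simp add: u)
qed

text \<open>
  All translates of \<open>Z\<close> have the same direction space, hence the choice operator picks the same orthonormal basis
  for each of them. Only the base points differ; they are dealt with by translation invariance of
  the product Lebesgue measure in \<open>PiM_lborel_AE_base_point\<close>.
\<close>

lemma affine_lebesgue_translate:
  fixes Z :: "'a::euclidean_space set"
  assumes "subspace Z"
  obtains B where "orthonormal_basis_of B Z"
    and "\<forall>\<mu>. \<exists>a\<in>translate \<mu> Z. affine_lebesgue (translate \<mu> Z)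
           = distr (Pi\<^sub>M B (\<lambda>_. lborel)) borel (\<lambda>f. a + (\<Sum>b\<in>B. f b *\<^sub>R b))"
proof
  define B where "B = (SOME B. orthonormal_basis_of B Z)"
  obtain B' where "B' \<subseteq> Z" "pairwise orthogonal B'" "\<And>x. x \<in> B' \<Longrightarrow> norm x = 1" "span B' = Z"
    using orthonormal_basis_subspace[OF assms] by metis
  then have "\<exists>B. orthonormal_basis_of B Z" by (auto simp: orthonormal_basis_of_def)
  then show "orthonormal_basis_of B Z" unfolding B_def by (rule someI_ex)
  show "\<forall>\<mu>. \<exists>a\<in>translate \<mu> Z. affine_lebesgue (translate \<mu> Z)
           = distr (Pi\<^sub>M B (\<lambda>_. lborel)) borel (\<lambda>f. a + (\<Sum>b\<in>B. f b *\<^sub>R b))"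
  proof
    fix \<mu>
    define a where "a = (SOME a. a \<in> translate \<mu> Z)"
    have "\<mu> + 0 \<in> translate \<mu> Z" using subspace_0[OF assms] unfolding translate_def by blast
    then have a: "a \<in> translate \<mu> Z" unfolding a_def by (rule someI)
    then obtain z where z: "z \<in> Z" "a = \<mu> + z" by (auto simp: translate_def)
    have "(\<lambda>x. x - a) ` translate \<mu> Z = Z"
    proof (intro equalityI subsetI)
      fix x assume "x \<in> (\<lambda>x. x - a) ` translate \<mu> Z"
      then show "x \<in> Z" using z assms by (auto simp: translate_def subspace_diff)
    next
      fix x assume "x \<in> Z"
      then have "x + z \<in> Z" using z assms by (simp add: subspace_add)
      then have "\<mu> + (x + z) \<in> translate \<mu> Z" by (auto simp: translate_def)
      then show "x \<in> (\<lambda>x. x - a) ` translate \<mu> Z" by (rule rev_image_eqI) (simp add: z)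
    qed
    then have "affine_lebesgue (translate \<mu> Z) = distr (Pi\<^sub>M B (\<lambda>_. lborel)) borel (\<lambda>f. a + (\<Sum>b\<in>B. f b *\<^sub>R b))"
      by (simp add: affine_lebesgue_def Let_def a_def B_def)
    then show "\<exists>a\<in>translate \<mu> Z. affine_lebesgue (translate \<mu> Z)
             = distr (Pi\<^sub>M B (\<lambda>_. lborel)) borel (\<lambda>f. a + (\<Sum>b\<in>B. f b *\<^sub>R b))"
      using a by blast
  qed
qed

lemma PiM_lborel_AE_base_point:
  fixes B :: "'a::euclidean_space set"
  assumes B: "orthonormal_basis_of B Z" and z: "a' - a \<in> Z"
    and AE: "AE f in Pi\<^sub>M B (\<lambda>_. lborel). P (a + (\<Sum>b\<in>B. f b *\<^sub>R b))"
  shows "AE f in Pi\<^sub>M B (\<lambda>_. lborel). P (a' + (\<Sum>b\<in>B. f b *\<^sub>R b))"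
proof -
  have fin: "finite B" using B by (rule orthonormal_basis_of_finite)
  define c where "c b = (a' - a) \<bullet> b" for b
  have c: "a' - a = (\<Sum>b\<in>B. c b *\<^sub>R b)"
    using orthonormal_basis_of_expansion[OF B z] by (simp add: c_def)
  have shift: "(\<lambda>t. \<lambda>b\<in>B. c b + t b) \<in> Pi\<^sub>M B (\<lambda>_. lborel) \<rightarrow>\<^sub>M Pi\<^sub>M B (\<lambda>_. lborel :: real measure)"
    by (rule measurable_restrict) measurable
  have "AE f in distr (Pi\<^sub>M B (\<lambda>_. lborel)) (Pi\<^sub>M B (\<lambda>_. lborel)) (\<lambda>t. \<lambda>b\<in>B. c b + t b). P (a + (\<Sum>b\<in>B. f b *\<^sub>R b))"
    unfolding distr_PiM_lborel_translate[OF fin] by (rule AE)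
  then have "AE f in Pi\<^sub>M B (\<lambda>_. lborel). P (a + (\<Sum>b\<in>B. (\<lambda>b\<in>B. c b + f b) b *\<^sub>R b))"
    by (rule AE_distrD[OF shift])
  moreover have "a + (\<Sum>b\<in>B. (\<lambda>b\<in>B. c b + f b) b *\<^sub>R b) = a' + (\<Sum>b\<in>B. f b *\<^sub>R b)" for f
  proof -
    have "(\<Sum>b\<in>B. (\<lambda>b\<in>B. c b + f b) b *\<^sub>R b) = (\<Sum>b\<in>B. c b *\<^sub>R b) + (\<Sum>b\<in>B. f b *\<^sub>R b)"
      by (simp add: scaleR_left_distrib sum.distrib)
    then show ?thesis by (simp add: c[symmetric])
  qed
  ultimately show ?thesis by simp
qed

text \<open>
  Null sets of \<open>\<mu> + Z\<close> pull back to null sets under \<open>x \<mapsto> \<mu> + A *v x\<close>. Choose \<open>v b\<close> with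
  \<open>A *v v b = b\<close> for every basis vector \<open>b\<close> and let \<open>E\<close> be the preimage of \<open>F\<close>. For fixed \<open>x\<close>, the set of
  coordinates \<open>t\<close> for which \<open>x\<close> translated by the sum of all \<open>t b *\<^sub>R v b\<close> lies in \<open>E\<close> is a translate of the null
  set of coordinates of \<open>F\<close>. For fixed \<open>t\<close>, the set of such \<open>x\<close> has the measure of \<open>E\<close>. By Tonelli's theorem, the
  measure of \<open>E\<close> times the positive total mass of the coordinate space is therefore zero.
\<close>

lemma linear_preimage_AE:
  fixes A :: "real^'n^'n"
  assumes B: "orthonormal_basis_of B Z"
    and range: "range ((*v) A) = Z"
    and F: "F \<in> sets borel"
    and a: "\<mu> - a \<in> Z"
    and AE: "AE f in Pi\<^sub>M B (\<lambda>_. lborel). a + (\<Sum>b\<in>B. f b *\<^sub>R b) \<notin> F"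
  shows "AE x in lborel. \<mu> + A *v x \<notin> F"
proof -
  have fin: "finite B" using B by (rule orthonormal_basis_of_finite)
  interpret P: product_sigma_finite "\<lambda>_::real^'n. lborel :: real measure" by standard
  interpret PB: sigma_finite_measure "Pi\<^sub>M B (\<lambda>_. lborel :: real measure)"
    by (rule P.sigma_finite) (rule fin)
  interpret Q: pair_sigma_finite "Pi\<^sub>M B (\<lambda>_. lborel :: real measure)" "lborel :: (real^'n) measure" ..
  have "\<forall>b\<in>B. \<exists>v. A *v v = b"
    using B range by (metis orthonormal_basis_of_def rangeE span_base)
  then obtain v where v: "\<And>b. b \<in> B \<Longrightarrow> A *v v b = b" by metis
  define E where "E = (\<lambda>x. \<mu> + A *v x) -` F"
  have E [measurable]: "E \<in> sets borel"
    unfolding E_def using measurable_sets[of "\<lambda>x. \<mu> + A *v x" borel borel F] F by simp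
  have F' [measurable]: "F \<in> sets borel" by (rule F)
  have zero: "(\<integral>\<^sup>+t. indicator E ((\<Sum>b\<in>B. t b *\<^sub>R v b) + x) \<partial>Pi\<^sub>M B (\<lambda>_. lborel)) = 0" for x
  proof -
    have "\<mu> + A *v x - a = (\<mu> - a) + A *v x" by simp
    moreover have "subspace Z" using B by (auto simp: orthonormal_basis_of_def)
    ultimately have "\<mu> + A *v x - a \<in> Z" using a range by (metis rangeI subspace_add)
    from PiM_lborel_AE_base_point[OF B this AE]
    have "AE t in Pi\<^sub>M B (\<lambda>_. lborel). indicator E ((\<Sum>b\<in>B. t b *\<^sub>R v b) + x) = (0::ennreal)"
    proof (rule AE_mp, intro AE_I2 impI)
      fix t assume "\<mu> + A *v x + (\<Sum>b\<in>B. t b *\<^sub>R b) \<notin> F"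
      moreover have "A *v ((\<Sum>b\<in>B. t b *\<^sub>R v b) + x) = (\<Sum>b\<in>B. t b *\<^sub>R b) + A *v x"
        using v by (simp add: matrix_vector_right_distrib linear_sum[OF matrix_vector_mul_linear] matrix_vector_mult_scaleR)
      ultimately show "indicator E ((\<Sum>b\<in>B. t b *\<^sub>R v b) + x) = (0::ennreal)"
        by (simp add: E_def add_ac)
    qed
    then show ?thesis by (subst nn_integral_0_iff_AE) simp_all
  qed
  have "emeasure lborel E * emeasure (Pi\<^sub>M B (\<lambda>_. lborel :: real measure)) (space (Pi\<^sub>M B (\<lambda>_. lborel)))
      = (\<integral>\<^sup>+t. \<integral>\<^sup>+x. indicator E ((\<Sum>b\<in>B. t b *\<^sub>R v b) + x) \<partial>lborel \<partial>Pi\<^sub>M B (\<lambda>_. lborel :: real measure))"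
    using nn_integral_lborel_translate[of "indicator E"] by simp
  also have "\<dots> = (\<integral>\<^sup>+x. \<integral>\<^sup>+t. indicator E ((\<Sum>b\<in>B. t b *\<^sub>R v b) + x) \<partial>Pi\<^sub>M B (\<lambda>_. lborel :: real measure) \<partial>lborel)"
    by (rule Q.Fubini'[symmetric]) measurable
  also have "\<dots> = 0" by (simp add: zero)
  finally have "emeasure lborel E = 0 \<or> emeasure (Pi\<^sub>M B (\<lambda>_. lborel :: real measure)) (space (Pi\<^sub>M B (\<lambda>_. lborel))) = 0"
    by simp
  moreover have "emeasure (Pi\<^sub>M B (\<lambda>_. lborel :: real measure)) (space (Pi\<^sub>M B (\<lambda>_. lborel))) \<noteq> 0"
    using P.emeasure_PiM[OF fin, of "\<lambda>_. UNIV"] by (simp add: space_PiM prod_zero_iff[OF fin])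
  ultimately have "E \<in> null_sets lborel" by (simp add: null_sets_def)
  then have "AE x in lborel. x \<notin> E" by (rule AE_not_in)
  then show ?thesis by (simp add: E_def)
qed

lemma range_matrix_eq_span_columns:
  fixes A :: "real^'n^'m"
  shows "range ((*v) A) = span (columns A)"
proof
  show "range ((*v) A) \<subseteq> span (columns A)"
    by (auto simp: matrix_vector_mult_in_columnspace)
  have "subspace (range ((*v) A))" by (rule linear_subspace_image) simp_all
  moreover have "columns A \<subseteq> range ((*v) A)"
    by (auto simp: columns_def matrix_vector_mult_basis[symmetric])
  ultimately show "span (columns A) \<subseteq> range ((*v) A)" by (intro span_minimal)
qed

text \<open>
  The nontrivial inclusion: a vector \<open>z\<close> orthogonal to the range of \<open>A ** transpose A\<close> satisfies
  \<open>transpose A *v z = 0\<close>, because the squared norm of that vector is \<open>z \<bullet> (A *v (transpose A *v z))\<close>; hence \<open>z\<close> is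
  orthogonal to the range of \<open>A\<close>.
\<close>

lemma range_factor:
  fixes A :: "real^'n^'n"
  shows "range ((*v) A) = span (columns (A ** transpose A))"
proof -
  let ?Z = "range ((*v) (A ** transpose A))"
  have Z: "subspace ?Z" by (rule linear_subspace_image) simp_all
  have "A *v x \<in> ?Z" for x
  proof -
    obtain y z where yz: "y \<in> span ?Z" "\<And>w. w \<in> span ?Z \<Longrightarrow> orthogonal z w" "A *v x = y + z"
      using orthogonal_subspace_decomp_exists[of ?Z "A *v x"] by blast
    have adj: "u \<bullet> (A *v w) = (transpose A *v u) \<bullet> w" for u w
      by (metis dot_lmul_matrix vector_transpose_matrix transpose_transpose)
    have "A *v (transpose A *v z) \<in> span ?Z"
      by (intro span_base) (simp only: matrix_vector_mul_assoc rangeI)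
    then have "z \<bullet> (A *v (transpose A *v z)) = 0" using yz(2) by (simp add: orthogonal_def)
    then have "transpose A *v z = 0" by (simp add: adj)
    then have "z \<bullet> (A *v x) = 0" by (simp add: adj)
    moreover have "z \<bullet> y = 0" using yz by (simp add: orthogonal_def)
    ultimately have "z = 0" using yz(3) by (simp add: inner_add_right)
    moreover have "span ?Z = ?Z" using Z by (simp only: span_eq_iff)
    ultimately show ?thesis using yz(1,3) by (metis add.right_neutral)
  qed
  then have "range ((*v) A) = ?Z" by (auto simp: matrix_vector_mul_assoc[symmetric])
  then show ?thesis by (simp add: range_matrix_eq_span_columns)
qed

section \<open>Gaussian measures concentrating on a subspace\<close>

lemma prob_space_gaussian_measure:
  assumes "sym_pos_def \<Phi>"
  shows "prob_space (gaussian_measure \<mu> \<Phi>)"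
proof -
  obtain A where A: "A ** transpose A = \<Phi>" "det A \<noteq> 0"
    using assms by (rule sym_pos_def_factor)
  interpret prob_space "std_gaussian :: (real^'a) measure" by (rule prob_space_std_gaussian)
  show ?thesis unfolding gaussian_measure_eq_distr[OF A]
    by (rule prob_space_distr) measurable
qed

lemma sym_pos_def_scaleR:
  assumes "sym_pos_def S" "0 < c"
  shows "sym_pos_def (c *\<^sub>R S)"
proof -
  have "transpose (c *\<^sub>R S) = c *\<^sub>R transpose S"
    by (simp add: transpose_def vec_eq_iff)
  with assms show ?thesis
    by (simp add: sym_pos_def_def scaleR_matrix_vector_assoc[symmetric])
qed

text \<open>
  The squared norm of the \<open>i\<close>-th row of a factor is the \<open>i\<close>-th diagonal entry of the covariance matrix, so
  factors of a convergent sequence of matrices are bounded and compactness applies.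
\<close>

lemma factor_subsequence:
  fixes S :: "nat \<Rightarrow> real^'n^'n"
  assumes pd: "\<And>m. sym_pos_def (S m)" and lim: "S \<longlonglongrightarrow> S0"
  obtains A \<sigma> A0 where "strict_mono (\<sigma> :: nat \<Rightarrow> nat)" "\<And>m. A m ** transpose (A m) = S m"
    "\<And>m. det (A m) \<noteq> 0" "(\<lambda>m. A (\<sigma> m)) \<longlonglongrightarrow> A0" "A0 ** transpose A0 = S0"
proof -
  have "\<forall>m. \<exists>A. A ** transpose A = S m \<and> det A \<noteq> 0"
  proof
    fix m
    show "\<exists>A. A ** transpose A = S m \<and> det A \<noteq> 0"
      using sym_pos_def_factor[OF pd[of m]] by blast
  qed
  from choice[OF this] obtain A where "\<forall>m. A m ** transpose (A m) = S m \<and> det (A m) \<noteq> 0" ..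
  then have A: "\<And>m. A m ** transpose (A m) = S m" and det: "\<And>m. det (A m) \<noteq> 0"
    by simp_all
  obtain K where K: "\<And>m. norm (S m) \<le> K"
    using convergent_imp_bounded[OF lim] by (auto simp: bounded_iff)
  have row: "norm (A m $ i) \<le> sqrt K" for m i
  proof -
    have "(norm (A m $ i))\<^sup>2 = S m $ i $ i"
      unfolding A[symmetric] by (simp add: matrix_matrix_mult_def transpose_def power2_norm_eq_inner inner_vec_def)
    also have "\<dots> \<le> norm (S m)"
    proof -
      have "S m $ i $ i \<le> norm (S m $ i)" using component_le_norm_cart[of "S m $ i" i] by simp
      also have "\<dots> \<le> norm (S m)" by (rule Finite_Cartesian_Product.norm_nth_le)
      finally show ?thesis .
    qed
    finally show ?thesis using K[of m] by (simp add: real_le_rsqrt)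
  qed
  have "norm (A m) \<le> CARD('n) * sqrt K" for m
  proof -
    have "norm (A m) \<le> (\<Sum>i\<in>UNIV. norm (A m $ i))"
      unfolding norm_vec_def by (rule L2_set_le_sum) simp
    also have "\<dots> \<le> (\<Sum>i\<in>(UNIV::'n set). sqrt K)" by (rule sum_mono) (rule row)
    finally show ?thesis by simp
  qed
  then have "bounded (range A)" by (auto simp: bounded_iff)
  then obtain A0 \<sigma> where \<sigma>: "strict_mono (\<sigma> :: nat \<Rightarrow> nat)" and conv: "(A \<circ> \<sigma>) \<longlonglongrightarrow> A0"
    using bounded_imp_convergent_subsequence by blast
  then have conv: "(\<lambda>m. A (\<sigma> m)) \<longlonglongrightarrow> A0" by (simp add: o_def)
  have "(\<lambda>m. A (\<sigma> m) ** transpose (A (\<sigma> m))) \<longlonglongrightarrow> A0 ** transpose A0"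
    unfolding matrix_matrix_mult_def transpose_def
    by (intro vec_tendstoI) (simp, intro tendsto_intros conv)
  then have "(S \<circ> \<sigma>) \<longlonglongrightarrow> A0 ** transpose A0" by (simp add: A o_def)
  moreover have "(S \<circ> \<sigma>) \<longlonglongrightarrow> S0" using lim \<sigma> by (rule LIMSEQ_subseq_LIMSEQ)
  ultimately have "A0 ** transpose A0 = S0" by (rule LIMSEQ_unique)
  with \<sigma> A det conv show thesis by (rule that)
qed

lemma translate_null:
  fixes Z :: "'a::euclidean_space set"
  assumes "subspace Z" "dim Z < DIM('a)"
  shows "translate \<mu> Z \<in> sets borel" "emeasure lborel (translate \<mu> Z) = 0"
proof -
  have "closed (translate \<mu> Z)"
    unfolding translate_def by (intro closed_translation closed_subspace assms)
  then show borel: "translate \<mu> Z \<in> sets borel" by simp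
  have "negligible (translate \<mu> Z)"
    unfolding translate_def by (intro negligible_translation negligible_lowdim assms)
  then show "emeasure lborel (translate \<mu> Z) = 0"
    using borel by (simp add: negligible_iff_null_sets null_sets_def emeasure_completion)
qed

text \<open>
  The means \<open>\<mu> m\<close> are allowed to move so that one statement serves both a fixed null mean and alternative
  means approaching it.
\<close>

lemma gaussian_concentration:
  fixes S :: "nat \<Rightarrow> real^'n^'n"
  assumes pd: "\<And>m. sym_pos_def (S m)" and lim: "S \<longlonglongrightarrow> S0"
    and Z: "span (columns S0) = Z" "dim Z < CARD('n)"
    and \<mu>: "\<mu> \<longlonglongrightarrow> \<mu>0"
    and V: "V \<in> sets borel"
    and null: "emeasure (affine_lebesgue (translate \<mu>0 Z)) (frontier (V \<union> translate \<mu>0 Z)) = 0"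
  obtains \<sigma> where "strict_mono (\<sigma> :: nat \<Rightarrow> nat)"
    "(\<lambda>m. measure (gaussian_measure (\<mu> (\<sigma> m)) (S (\<sigma> m))) V) \<longlonglongrightarrow> 1"
proof -
  obtain A \<sigma> A0 where \<sigma>: "strict_mono (\<sigma> :: nat \<Rightarrow> nat)" and A: "\<And>m. A m ** transpose (A m) = S m"
    "\<And>m. det (A m) \<noteq> 0" and conv: "(\<lambda>m. A (\<sigma> m)) \<longlonglongrightarrow> A0" and A0: "A0 ** transpose A0 = S0"
    using factor_subsequence[OF pd lim] by blast
  have range: "range ((*v) A0) = Z" by (simp only: range_factor A0 Z)
  have "subspace Z" using Z by auto
  define y where "y m x = \<mu> (\<sigma> m) + A (\<sigma> m) *v x" for m x
  have y_meas [measurable]: "y m \<in> borel_measurable borel" for m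
    unfolding y_def by measurable
  have gauss: "gaussian_measure (\<mu> (\<sigma> m)) (S (\<sigma> m)) = distr std_gaussian borel (y m)" for m
    unfolding y_def by (rule gaussian_measure_eq_distr[OF A])
  interpret prob_space "std_gaussian :: (real^'n) measure" by (rule prob_space_std_gaussian)
  \<comment> \<open>Almost surely the limit point avoids the boundary, and no approximating point lies on \<open>\<mu>0 + Z\<close>.\<close>
  let ?F = "frontier (V \<union> translate \<mu>0 Z)"
  obtain B where B: "orthonormal_basis_of B Z"
    and base: "\<forall>\<mu>. \<exists>a\<in>translate \<mu> Z. affine_lebesgue (translate \<mu> Z)
           = distr (Pi\<^sub>M B (\<lambda>_. lborel)) borel (\<lambda>f. a + (\<Sum>b\<in>B. f b *\<^sub>R b))"
    using affine_lebesgue_translate[OF \<open>subspace Z\<close>] by blast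
  obtain a where a: "a \<in> translate \<mu>0 Z"
    and leb: "affine_lebesgue (translate \<mu>0 Z) = distr (Pi\<^sub>M B (\<lambda>_. lborel)) borel (\<lambda>f. a + (\<Sum>b\<in>B. f b *\<^sub>R b))"
    using base by blast
  have F: "?F \<in> sets borel" by simp
  have "AE f in Pi\<^sub>M B (\<lambda>_. lborel). a + (\<Sum>b\<in>B. f b *\<^sub>R b) \<notin> ?F"
  proof -
    have "AE w in affine_lebesgue (translate \<mu>0 Z). w \<notin> ?F"
      by (rule AE_not_in) (use null in \<open>simp add: null_sets_def leb\<close>)
    then show ?thesis unfolding leb by (rule AE_distrD[rotated]) measurable
  qed
  moreover have "\<mu>0 - a \<in> Z"
    using a \<open>subspace Z\<close> by (auto simp: translate_def subspace_neg)
  ultimately have "AE x in lborel. \<mu>0 + A0 *v x \<notin> ?F"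
    by (intro linear_preimage_AE[OF B range F])
  then have "AE x in std_gaussian. \<mu>0 + A0 *v x \<notin> ?F"
    unfolding gaussian_measure_def by (subst AE_density) auto
  moreover have "AE x in std_gaussian. \<forall>m. y m x \<notin> translate \<mu>0 Z"
  proof (subst AE_all_countable, intro allI)
    fix m
    have "translate \<mu>0 Z \<in> null_sets (gaussian_measure (\<mu> (\<sigma> m)) (S (\<sigma> m)))"
      using translate_null[of Z \<mu>0] \<open>subspace Z\<close> Z
      by (simp add: null_sets_def gaussian_measure_null)
    from AE_not_in[OF this] show "AE x in std_gaussian. y m x \<notin> translate \<mu>0 Z"
      unfolding gauss by (rule AE_distrD[rotated]) measurable
  qed
  \<comment> \<open>The limit point belongs to \<open>\<mu>0 + Z\<close>, hence to the interior of \<open>V \<union> (\<mu>0 + Z)\<close>, and so do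
    almost all approximating points; these then lie in \<open>V\<close>, as they avoid \<open>\<mu>0 + Z\<close>.\<close>
  ultimately have ae: "AE x in std_gaussian. (\<lambda>m. indicat_real V (y m x)) \<longlonglongrightarrow> 1"
  proof eventually_elim
    case (elim x)
    have "\<mu>0 + A0 *v x \<in> V \<union> translate \<mu>0 Z"
      using range by (auto simp: translate_def)
    then have "\<mu>0 + A0 *v x \<in> interior (V \<union> translate \<mu>0 Z)"
      using elim(1) closure_subset by (auto simp: frontier_def)
    moreover have "(\<lambda>m. y m x) \<longlonglongrightarrow> \<mu>0 + A0 *v x"
    proof -
      have "(\<lambda>m. A (\<sigma> m) *v x) \<longlonglongrightarrow> A0 *v x"
        unfolding matrix_vector_mult_def by (intro vec_tendstoI) (simp, intro tendsto_intros conv)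
      moreover have "(\<lambda>m. \<mu> (\<sigma> m)) \<longlonglongrightarrow> \<mu>0"
        using LIMSEQ_subseq_LIMSEQ[OF \<mu> \<sigma>] by (simp add: o_def)
      ultimately show ?thesis unfolding y_def by (intro tendsto_add)
    qed
    ultimately have "eventually (\<lambda>m. y m x \<in> interior (V \<union> translate \<mu>0 Z)) sequentially"
      by (intro topological_tendstoD) auto
    then have "eventually (\<lambda>m. indicat_real V (y m x) = 1) sequentially"
      by (rule eventually_mono) (use elim(2) interior_subset in \<open>fastforce simp: indicator_def\<close>)
    then show ?case by (rule tendsto_eventually)
  qed
  have "(\<lambda>m. \<integral>x. indicat_real V (y m x) \<partial>std_gaussian) \<longlonglongrightarrow> (\<integral>x. 1 \<partial>(std_gaussian :: (real^'n) measure))"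
    by (rule integral_dominated_convergence[where w="\<lambda>_. 1"]) (use V ae in auto)
  moreover have "(\<integral>x. indicat_real V (y m x) \<partial>std_gaussian) = measure (gaussian_measure (\<mu> (\<sigma> m)) (S (\<sigma> m))) V" for m
  proof -
    have "(\<integral>x. indicat_real V (y m x) \<partial>std_gaussian) = (\<integral>w. indicat_real V w \<partial>distr std_gaussian borel (y m))"
      using V by (subst integral_distr) auto
    then show ?thesis using V by (simp add: gauss)
  qed
  ultimately have "(\<lambda>m. measure (gaussian_measure (\<mu> (\<sigma> m)) (S (\<sigma> m))) V) \<longlonglongrightarrow> 1"
    using prob_space by simp
  with \<sigma> show thesis by (rule that)
qed

lemma concentration_space_power:
  fixes \<CC> :: "(real^'n^'n) set"
  assumes "covariance_model \<CC>" and Z: "concentration_space \<CC> Z"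
    and V: "V \<in> sets borel"
    and null: "emeasure (affine_lebesgue (translate \<mu>0 Z)) (frontier (V \<union> translate \<mu>0 Z)) = 0"
    and \<mu>: "\<mu> \<longlonglongrightarrow> \<mu>0" and s2: "0 < s2" and e: "0 < e"
  shows "\<exists>m. \<exists>S\<in>\<CC>. 1 - e < measure (gaussian_measure (\<mu> m) (s2 *\<^sub>R S)) V"
proof -
  obtain S S0 where S: "\<And>m. S m \<in> \<CC>" "S \<longlonglongrightarrow> S0" "span (columns S0) = Z" "dim Z < CARD('n)"
    using Z by (auto simp: concentration_space_def)
  have pd: "sym_pos_def (s2 *\<^sub>R S m)" for m
    using assms(1) S(1) s2 by (auto simp: covariance_model_def intro: sym_pos_def_scaleR)
  have "(\<lambda>m. s2 *\<^sub>R S m) \<longlonglongrightarrow> s2 *\<^sub>R S0" by (intro tendsto_intros S)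
  moreover have "span (columns (s2 *\<^sub>R S0)) = Z"
  proof -
    have "range ((*v) (s2 *\<^sub>R S0)) = range ((*v) S0)"
    proof (intro equalityI subsetI)
      fix w assume "w \<in> range ((*v) (s2 *\<^sub>R S0))"
      then show "w \<in> range ((*v) S0)"
        by (auto simp: scaleR_matrix_vector_assoc[symmetric] matrix_vector_mult_scaleR[symmetric])
    next
      fix w assume "w \<in> range ((*v) S0)"
      then obtain x where "w = S0 *v x" by auto
      then have "w = (s2 *\<^sub>R S0) *v ((1 / s2) *\<^sub>R x)"
        using s2 by (simp add: scaleR_matrix_vector_assoc[symmetric] matrix_vector_mult_scaleR)
      then show "w \<in> range ((*v) (s2 *\<^sub>R S0))" by blast
    qed
    then show ?thesis using S(3) by (simp add: range_matrix_eq_span_columns)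
  qed
  ultimately obtain \<sigma> where "strict_mono (\<sigma> :: nat \<Rightarrow> nat)"
    and "(\<lambda>m. measure (gaussian_measure (\<mu> (\<sigma> m)) (s2 *\<^sub>R S (\<sigma> m))) V) \<longlonglongrightarrow> 1"
    using gaussian_concentration[where S = "\<lambda>m. s2 *\<^sub>R S m", OF pd _ _ S(4) \<mu> V null] by blast
  from order_tendstoD(1)[OF this(2), of "1 - e"] e
  have "eventually (\<lambda>m. 1 - e < measure (gaussian_measure (\<mu> (\<sigma> m)) (s2 *\<^sub>R S (\<sigma> m))) V) sequentially"
    by simp
  then show ?thesis using S(1) by (auto simp: eventually_sequentially)
qed

text \<open>
  A point of \<open>\<mu>0 + Z\<close> with a neighbourhood inside \<open>V\<close> is interior to \<open>V \<union> (\<mu>0 + Z)\<close>, hence not on its boundary.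
  Semicontinuity of a test statistic provides such neighbourhoods, for the rejection region or its complement.
\<close>

lemma frontier_null_if_interior_AE:
  fixes Z :: "'a::euclidean_space set"
  assumes Z: "subspace Z"
    and AE: "AE z in affine_lebesgue Z. z \<in> Z \<longrightarrow> eventually (\<lambda>y. y \<in> V) (nhds (\<mu>0 + z))"
  shows "emeasure (affine_lebesgue (translate \<mu>0 Z)) (frontier (V \<union> translate \<mu>0 Z)) = 0"
proof -
  obtain B where B: "orthonormal_basis_of B Z"
    and leb: "\<forall>\<mu>. \<exists>a\<in>translate \<mu> Z. affine_lebesgue (translate \<mu> Z)
           = distr (Pi\<^sub>M B (\<lambda>_. lborel)) borel (\<lambda>f. a + (\<Sum>b\<in>B. f b *\<^sub>R b))"
    using affine_lebesgue_translate[OF Z] by blast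
  obtain a where a: "a \<in> translate \<mu>0 Z"
    and leb1: "affine_lebesgue (translate \<mu>0 Z) = distr (Pi\<^sub>M B (\<lambda>_. lborel)) borel (\<lambda>f. a + (\<Sum>b\<in>B. f b *\<^sub>R b))"
    using leb by blast
  have "translate 0 Z = Z" by (simp add: translate_def)
  moreover have "\<exists>a\<in>translate 0 Z. affine_lebesgue (translate 0 Z)
           = distr (Pi\<^sub>M B (\<lambda>_. lborel)) borel (\<lambda>f. a + (\<Sum>b\<in>B. f b *\<^sub>R b))"
    using leb by blast
  ultimately obtain a' where a': "a' \<in> Z"
    and leb0: "affine_lebesgue Z = distr (Pi\<^sub>M B (\<lambda>_. lborel)) borel (\<lambda>f. a' + (\<Sum>b\<in>B. f b *\<^sub>R b))"
    by auto
  let ?P = "\<lambda>z. z \<in> Z \<longrightarrow> eventually (\<lambda>y. y \<in> V) (nhds (\<mu>0 + z))"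
  have inZ: "(\<Sum>b\<in>B. f b *\<^sub>R b) \<in> Z" for f
  proof -
    have "(\<Sum>b\<in>B. f b *\<^sub>R b) \<in> span B" by (intro span_sum span_scale span_base)
    then show ?thesis using B by (simp add: orthonormal_basis_of_def)
  qed
  have P: "AE f in Pi\<^sub>M B (\<lambda>_. lborel). ?P (a' + (\<Sum>b\<in>B. f b *\<^sub>R b))"
    using AE unfolding leb0 by (rule AE_distrD[rotated]) measurable
  obtain z where z: "z \<in> Z" "a = \<mu>0 + z" using a by (auto simp: translate_def)
  have "z - a' \<in> Z" using z a' Z by (simp add: subspace_diff)
  then have "AE f in Pi\<^sub>M B (\<lambda>_. lborel). ?P (z + (\<Sum>b\<in>B. f b *\<^sub>R b))"
    by (rule PiM_lborel_AE_base_point[OF B _ P])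
  then have "AE f in Pi\<^sub>M B (\<lambda>_. lborel). a + (\<Sum>b\<in>B. f b *\<^sub>R b) \<notin> frontier (V \<union> translate \<mu>0 Z)"
  proof eventually_elim
    case (elim f)
    have "z + (\<Sum>b\<in>B. f b *\<^sub>R b) \<in> Z" using z inZ Z by (simp add: subspace_add)
    with elim obtain U where "open U" "\<mu>0 + (z + (\<Sum>b\<in>B. f b *\<^sub>R b)) \<in> U" "U \<subseteq> V"
      by (auto simp: eventually_nhds)
    then have "a + (\<Sum>b\<in>B. f b *\<^sub>R b) \<in> interior (V \<union> translate \<mu>0 Z)"
      unfolding interior_def z by (auto simp: add.assoc)
    then show ?case by (simp add: frontier_def)
  qed
  then have "AE y in affine_lebesgue (translate \<mu>0 Z). y \<notin> frontier (V \<union> translate \<mu>0 Z)"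
    unfolding leb1 by (subst AE_distr_iff) (simp_all add: Compl_eq[symmetric] borel_comp)
  then have "frontier (V \<union> translate \<mu>0 Z) \<in> null_sets (affine_lebesgue (translate \<mu>0 Z))"
    by (subst AE_iff_null_sets) (simp_all add: leb1)
  then show ?thesis by (rule null_setsD1)
qed

section \<open>Dilations about a mean and dependence on the mean\<close>

text \<open>
  The left-hand side is the original Gaussian probability of the preimage of \<open>W\<close> under the dilation. By almost
  invariance this preimage differs from \<open>W\<close> by a Lebesgue null set, which Gaussian measures do not charge.
\<close>

lemma gaussian_measure_scale_invariant:
  fixes \<Phi> :: "real^'n^'n"
  assumes pd: "sym_pos_def \<Phi>" and W: "W \<in> sets borel"
    and inv: "almost_invariant_set (scale_group \<mu>0) W" and \<alpha>: "\<alpha> \<noteq> 0"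
  shows "measure (gaussian_measure (\<mu>0 + \<alpha> *\<^sub>R (\<mu> - \<mu>0)) (\<alpha>\<^sup>2 *\<^sub>R \<Phi>)) W = measure (gaussian_measure \<mu> \<Phi>) W"
proof -
  obtain A where A: "A ** transpose A = \<Phi>" "det A \<noteq> 0"
    using pd by (rule sym_pos_def_factor)
  define g where "g y = \<alpha> *\<^sub>R (y - \<mu>0) + \<mu>0" for y
  have g_meas [measurable]: "g \<in> borel_measurable borel" unfolding g_def by measurable
  have "g \<in> scale_group \<mu>0" using \<alpha> unfolding scale_group_def g_def[abs_def] by blast
  then obtain N where N: "N \<in> sets borel" "emeasure lborel N = 0"
    and eq: "\<And>y. y \<notin> N \<Longrightarrow> indicat_real W (g y) = indicat_real W y"
    using inv unfolding almost_invariant_set_def almost_invariant_def by blast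
  have tr: "transpose (\<alpha> *\<^sub>R A) = \<alpha> *\<^sub>R transpose A" by (simp add: transpose_def vec_eq_iff)
  have "(\<alpha> *\<^sub>R A) ** transpose (\<alpha> *\<^sub>R A) = \<alpha>\<^sup>2 *\<^sub>R \<Phi>"
    unfolding A(1)[symmetric] tr
    by (simp add: matrix_matrix_mult_def vec_eq_iff sum_distrib_left power2_eq_square mult_ac)
  moreover have "det (\<alpha> *\<^sub>R A) \<noteq> 0"
  proof -
    have "\<alpha> *\<^sub>R A = (\<chi> i. \<alpha> *s A $ i)" by (simp add: vec_eq_iff)
    then show ?thesis using A(2) \<alpha> det_rows_mul[of "\<lambda>_. \<alpha>" "\<lambda>i. A $ i"] by simp
  qed
  ultimately have "gaussian_measure (\<mu>0 + \<alpha> *\<^sub>R (\<mu> - \<mu>0)) (\<alpha>\<^sup>2 *\<^sub>R \<Phi>)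
      = distr std_gaussian borel (\<lambda>x. (\<mu>0 + \<alpha> *\<^sub>R (\<mu> - \<mu>0)) + (\<alpha> *\<^sub>R A) *v x)"
    by (rule gaussian_measure_eq_distr)
  also have "\<dots> = distr std_gaussian borel (g \<circ> (\<lambda>x. \<mu> + A *v x))"
    by (rule distr_cong) (simp_all add: g_def scaleR_matrix_vector_assoc[symmetric] algebra_simps)
  also have "\<dots> = distr (gaussian_measure \<mu> \<Phi>) borel g"
    unfolding gaussian_measure_eq_distr[OF A] by (rule distr_distr[symmetric]) measurable
  finally have "measure (gaussian_measure (\<mu>0 + \<alpha> *\<^sub>R (\<mu> - \<mu>0)) (\<alpha>\<^sup>2 *\<^sub>R \<Phi>)) W
      = measure (gaussian_measure \<mu> \<Phi>) (g -` W)"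
    using W by (simp add: measure_distr)
  also have "\<dots> = measure (gaussian_measure \<mu> \<Phi>) W"
  proof (rule measure_eq_AE)
    have "N \<in> null_sets (gaussian_measure \<mu> \<Phi>)"
      using N by (simp add: null_sets_def gaussian_measure_null)
    from AE_not_in[OF this] show "AE y in gaussian_measure \<mu> \<Phi>. y \<in> g -` W \<longleftrightarrow> y \<in> W"
    proof eventually_elim
      case (elim y)
      from eq[OF elim] show ?case by (cases "g y \<in> W"; cases "y \<in> W") simp_all
    qed
  qed (use W measurable_sets[OF g_meas W] in auto)
  finally show ?thesis .
qed

text \<open>
  The density depends continuously on the mean, so Fatou's lemma gives lower semicontinuity. Applied to
  the complement of a set, it bounds the probability of the set from above near \<open>\<mu>0\<close>.
\<close>

lemma gaussian_measure_mean_lower_semicontinuous: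
  fixes \<Phi> :: "real^'n^'n"
  assumes \<mu>: "\<mu> \<longlonglongrightarrow> \<mu>0" and V: "V \<in> sets borel"
    and c: "c < emeasure (gaussian_measure \<mu>0 \<Phi>) V"
  shows "eventually (\<lambda>m. c < emeasure (gaussian_measure (\<mu> m) \<Phi>) V) sequentially"
proof -
  define f where "f \<nu> y = ennreal (exp (- ((y - \<nu>) \<bullet> (matrix_inv \<Phi> *v (y - \<nu>))) / 2)
                                  / sqrt ((2 * pi) ^ CARD('n) * det \<Phi>)) * indicator V y" for \<nu> y
  have f_meas [measurable]: "f \<nu> \<in> borel_measurable borel" for \<nu>
    unfolding f_def using V by measurable
  have em: "emeasure (gaussian_measure \<nu> \<Phi>) V = (\<integral>\<^sup>+y. f \<nu> y \<partial>lborel)" for \<nu>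
    unfolding gaussian_measure_def f_def using V by (subst emeasure_density) simp_all
  have "(\<lambda>m. f (\<mu> m) y) \<longlonglongrightarrow> f \<mu>0 y" for y
  proof -
    have "(\<lambda>m. matrix_inv \<Phi> *v (y - \<mu> m)) \<longlonglongrightarrow> matrix_inv \<Phi> *v (y - \<mu>0)"
      by (intro bounded_linear.tendsto[OF matrix_vector_mul_bounded_linear] tendsto_intros \<mu>)
    then have "(\<lambda>m. exp (- ((y - \<mu> m) \<bullet> (matrix_inv \<Phi> *v (y - \<mu> m))) / 2)
                    * inverse (sqrt ((2 * pi) ^ CARD('n) * det \<Phi>)))
        \<longlonglongrightarrow> exp (- ((y - \<mu>0) \<bullet> (matrix_inv \<Phi> *v (y - \<mu>0))) / 2) * inverse (sqrt ((2 * pi) ^ CARD('n) * det \<Phi>))"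
      by (intro tendsto_mult tendsto_exp tendsto_divide tendsto_minus tendsto_inner tendsto_diff tendsto_const \<mu>) simp_all
    from tendsto_ennrealI[OF this] show ?thesis
      unfolding f_def divide_inverse[of "exp _"] by (cases "y \<in> V") simp_all
  qed
  then have "f \<mu>0 y = liminf (\<lambda>m. f (\<mu> m) y)" for y
    by (rule lim_imp_Liminf[OF sequentially_bot, symmetric])
  then have "(\<integral>\<^sup>+y. f \<mu>0 y \<partial>lborel) = (\<integral>\<^sup>+y. liminf (\<lambda>m. f (\<mu> m) y) \<partial>lborel)"
    by (intro nn_integral_cong)
  also have "\<dots> \<le> liminf (\<lambda>m. \<integral>\<^sup>+y. f (\<mu> m) y \<partial>lborel)"
    by (rule nn_integral_liminf) simp
  finally have "c < liminf (\<lambda>m. \<integral>\<^sup>+y. f (\<mu> m) y \<partial>lborel)"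
    using c by (simp add: em)
  then show ?thesis unfolding em by (rule less_LiminfD)
qed

section \<open>Size and power\<close>

lemma real_SUP_eqI:
  fixes f :: "'a \<Rightarrow> real"
  assumes "\<And>x. x \<in> A \<Longrightarrow> f x \<le> c" and "\<And>e. 0 < e \<Longrightarrow> \<exists>x\<in>A. c - e < f x"
  shows "(SUP x\<in>A. f x) = c"
proof (rule antisym)
  have ne: "A \<noteq> {}" using assms(2)[of 1] by auto
  then show "(SUP x\<in>A. f x) \<le> c" by (rule cSUP_least) (rule assms(1))
  have bdd: "bdd_above (f ` A)" using assms(1) by (auto simp: bdd_above_def)
  show "c \<le> (SUP x\<in>A. f x)"
  proof (rule field_le_epsilon)
    fix e :: real assume "0 < e"
    from assms(2)[OF this] obtain x where "x \<in> A" "c - e < f x" by blast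
    then show "c \<le> (SUP x\<in>A. f x) + e" using cSUP_upper[OF \<open>x \<in> A\<close> bdd] by linarith
  qed
qed

lemma real_INF_eq_0I:
  fixes f :: "'a \<Rightarrow> real"
  assumes "\<And>x. x \<in> A \<Longrightarrow> 0 \<le> f x" and "\<And>e. 0 < e \<Longrightarrow> \<exists>x\<in>A. f x < e"
  shows "(INF x\<in>A. f x) = 0"
proof (rule antisym)
  have ne: "A \<noteq> {}" using assms(2)[of 1] by auto
  then show "0 \<le> (INF x\<in>A. f x)" by (rule cINF_greatest) (rule assms(1))
  have bdd: "bdd_below (f ` A)" using assms(1) by (auto simp: bdd_below_def)
  show "(INF x\<in>A. f x) \<le> 0"
  proof (rule field_le_epsilon)
    fix e :: real assume "0 < e"
    from assms(2)[OF this] obtain x where "x \<in> A" "f x < e" by blast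
    then show "(INF x\<in>A. f x) \<le> 0 + e" using cINF_lower[OF bdd \<open>x \<in> A\<close>] by linarith
  qed
qed

lemma real_INF_INF_eq_0I:
  fixes f :: "'a \<Rightarrow> 'b \<Rightarrow> real"
  assumes nonneg: "\<And>x y. 0 \<le> f x y" and "B \<noteq> {}"
    and small: "\<And>e. 0 < e \<Longrightarrow> \<exists>x\<in>A. \<exists>y\<in>B. f x y < e"
  shows "(INF x\<in>A. INF y\<in>B. f x y) = 0"
proof (rule real_INF_eq_0I)
  show "0 \<le> (INF y\<in>B. f x y)" for x
    by (rule cINF_greatest) (use assms in auto)
  fix e :: real assume "0 < e"
  then obtain x y where xy: "x \<in> A" "y \<in> B" "f x y < e" using small by blast
  have "(INF y\<in>B. f x y) \<le> f x y"
    by (rule cINF_lower[OF _ xy(2)]) (use nonneg in \<open>auto simp: bdd_below_def\<close>)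
  then show "\<exists>x\<in>A. (INF y\<in>B. f x y) < e" using xy by force
qed

lemma real_INF_less_D:
  fixes f :: "'a \<Rightarrow> real"
  assumes "(INF x\<in>A. f x) < e" "A \<noteq> {}"
  shows "\<exists>x\<in>A. f x < e"
  using assms cINF_greatest[of A e f] by (meson linorder_not_less)

lemma alt_means_nonempty:
  fixes X :: "real^'k^'n" and R :: "real^'k^'q"
  assumes X: "rank X = CARD('k)" and R: "rank R = CARD('q)"
  shows "alt_means X R r \<noteq> {}"
proof -
  have inj: "inj ((*v) X)" using X by (simp add: full_rank_injective)
  have "R \<noteq> 0" using R by (auto simp: rank_0 zero_less_card_finite)
  then obtain \<beta>1 where "R *v \<beta>1 \<noteq> 0" by (metis matrix_eq matrix_vector_mult_0)
  then have "R *v 0 \<noteq> r \<or> R *v \<beta>1 \<noteq> r" by auto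
  then obtain \<beta> where \<beta>: "R *v \<beta> \<noteq> r" by blast
  have "X *v \<beta> \<in> mean_space X" by (simp add: mean_space_def matrix_vector_mult_in_columnspace)
  moreover have "X *v \<beta> \<notin> null_means X R r"
    using inj \<beta> by (auto simp: null_means_def inj_eq)
  ultimately show ?thesis by (auto simp: alt_means_def)
qed

text \<open>
  The affine constraint \<open>R *v \<beta> = r\<close> that holds at \<open>\<mu>0\<close> and fails at \<open>\<mu>1\<close> fails at every other point of
  the line through them, since a full column rank of \<open>X\<close> makes \<open>\<beta>\<close> an affine function of the mean.
\<close>

lemma alt_means_contract:
  fixes X :: "real^'k^'n" and R :: "real^'k^'q"
  assumes X: "rank X = CARD('k)" and \<mu>0: "\<mu>0 \<in> null_means X R r" and \<mu>1: "\<mu>1 \<in> alt_means X R r"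
    and t: "t \<noteq> 0"
  shows "\<mu>0 + t *\<^sub>R (\<mu>1 - \<mu>0) \<in> alt_means X R r"
proof -
  have inj: "inj ((*v) X)" using X by (simp add: full_rank_injective)
  obtain \<beta>0 where \<beta>0: "\<mu>0 = X *v \<beta>0" "R *v \<beta>0 = r" using \<mu>0 by (auto simp: null_means_def)
  have "\<mu>1 \<in> range ((*v) X)"
    using \<mu>1 by (auto simp: alt_means_def mean_space_def range_matrix_eq_span_columns)
  then obtain \<beta>1 where \<beta>1: "\<mu>1 = X *v \<beta>1" by blast
  then have "R *v \<beta>1 \<noteq> r" using \<mu>1 by (auto simp: alt_means_def null_means_def)
  define \<beta> where "\<beta> = \<beta>0 + t *\<^sub>R (\<beta>1 - \<beta>0)"
  have eq: "\<mu>0 + t *\<^sub>R (\<mu>1 - \<mu>0) = X *v \<beta>"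
    by (simp add: \<beta>_def \<beta>0 \<beta>1 matrix_vector_right_distrib matrix_vector_mult_scaleR matrix_vector_mult_diff_distrib)
  have "R *v \<beta> = r + t *\<^sub>R (R *v \<beta>1 - r)"
    by (simp add: \<beta>_def \<beta>0 matrix_vector_right_distrib matrix_vector_mult_scaleR matrix_vector_mult_diff_distrib)
  then have "R *v \<beta> \<noteq> r" using t \<open>R *v \<beta>1 \<noteq> r\<close> by simp
  then have "X *v \<beta> \<notin> null_means X R r" using inj by (auto simp: null_means_def inj_eq)
  moreover have "X *v \<beta> \<in> mean_space X" by (simp add: mean_space_def matrix_vector_mult_in_columnspace)
  ultimately show ?thesis by (simp add: eq alt_means_def)
qed

lemma tendsto_contract:
  fixes \<mu>0 \<mu>1 :: "'a::real_normed_vector"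
  shows "(\<lambda>m. \<mu>0 + (1 / real (Suc m)) *\<^sub>R (\<mu>1 - \<mu>0)) \<longlonglongrightarrow> \<mu>0"
proof -
  have "(\<lambda>m. \<mu>0 + (1 / real (Suc m)) *\<^sub>R (\<mu>1 - \<mu>0)) \<longlonglongrightarrow> \<mu>0 + 0 *\<^sub>R (\<mu>1 - \<mu>0)"
    by (intro tendsto_intros LIMSEQ_Suc lim_1_over_n)
  then show ?thesis by simp
qed

text \<open>
  With \<open>\<alpha> = 1 / Suc m\<close>, the power at \<open>\<mu>1\<close> and variance \<open>s2 / \<alpha>\<^sup>2\<close> is the power at the contracted mean
  \<open>\<mu>0 + \<alpha> (\<mu>1 - \<mu>0)\<close> and variance \<open>s2\<close>. Choosing first \<open>S\<close> with small power at \<open>\<mu>0\<close> and then \<open>m\<close> large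
  makes it small.
\<close>

lemma power_zero_at_alternative:
  fixes \<CC> :: "(real^'n^'n) set"
  assumes model: "covariance_model \<CC>" and W: "W \<in> sets borel"
    and inf0: "(INF S\<in>\<CC>. measure (gaussian_measure \<mu>0 (s2 *\<^sub>R S)) W) = 0" and s2: "0 < s2"
    and inv: "almost_invariant_set (scale_group \<mu>0) W"
  shows "(INF t2\<in>{0<..}. INF S\<in>\<CC>. measure (gaussian_measure \<mu>1 (t2 *\<^sub>R S)) W) = 0"
proof (rule real_INF_INF_eq_0I)
  show ne: "\<CC> \<noteq> {}" using model by (simp add: covariance_model_def)
  fix e' :: real assume "0 < e'"
  \<comment> \<open>Capping at one keeps \<open>1 - e\<close> nonnegative, so that its image in the extended reals is not truncated.\<close>
  define e where "e = min e' 1"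
  have "0 < e" "e \<le> 1" "e \<le> e'" using \<open>0 < e'\<close> by (auto simp: e_def)
  then obtain S where S: "S \<in> \<CC>" and small: "measure (gaussian_measure \<mu>0 (s2 *\<^sub>R S)) W < e"
    using real_INF_less_D[of "\<lambda>S. measure (gaussian_measure \<mu>0 (s2 *\<^sub>R S)) W" \<CC> e] inf0 ne by auto
  have pd: "sym_pos_def (c *\<^sub>R S)" if "0 < c" for c
    using model S that by (auto simp: covariance_model_def intro: sym_pos_def_scaleR)
  have compl: "emeasure (gaussian_measure \<mu> (s2 *\<^sub>R S)) (- W) = ennreal (1 - measure (gaussian_measure \<mu> (s2 *\<^sub>R S)) W)" for \<mu>
  proof -
    interpret prob_space "gaussian_measure \<mu> (s2 *\<^sub>R S)" by (rule prob_space_gaussian_measure) (rule pd[OF s2])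
    show ?thesis using prob_compl[of W] W by (simp add: emeasure_eq_measure Compl_eq_Diff_UNIV)
  qed
  define \<mu> where "\<mu> m = \<mu>0 + (1 / real (Suc m)) *\<^sub>R (\<mu>1 - \<mu>0)" for m
  have "\<mu> \<longlonglongrightarrow> \<mu>0" unfolding \<mu>_def by (rule tendsto_contract)
  moreover have "- W \<in> sets borel" using W by (rule borel_comp)
  moreover have "ennreal (1 - e) < emeasure (gaussian_measure \<mu>0 (s2 *\<^sub>R S)) (- W)"
  proof -
    interpret prob_space "gaussian_measure \<mu>0 (s2 *\<^sub>R S)" by (rule prob_space_gaussian_measure) (rule pd[OF s2])
    show ?thesis unfolding compl using small \<open>0 < e\<close> \<open>e \<le> 1\<close> by (intro ennreal_lessI) simp_all
  qed
  ultimately have "eventually (\<lambda>m. ennreal (1 - e) < emeasure (gaussian_measure (\<mu> m) (s2 *\<^sub>R S)) (- W)) sequentially"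
    by (rule gaussian_measure_mean_lower_semicontinuous)
  then obtain m where "ennreal (1 - e) < emeasure (gaussian_measure (\<mu> m) (s2 *\<^sub>R S)) (- W)"
    by (auto simp: eventually_sequentially)
  then have m: "measure (gaussian_measure (\<mu> m) (s2 *\<^sub>R S)) W < e"
  proof (rule contrapos_pp)
    assume "\<not> measure (gaussian_measure (\<mu> m) (s2 *\<^sub>R S)) W < e"
    then show "\<not> ennreal (1 - e) < emeasure (gaussian_measure (\<mu> m) (s2 *\<^sub>R S)) (- W)"
      unfolding compl by (simp add: not_less ennreal_leI)
  qed
  let ?\<alpha> = "1 / real (Suc m)"
  have "measure (gaussian_measure (\<mu> m) (?\<alpha>\<^sup>2 *\<^sub>R ((s2 / ?\<alpha>\<^sup>2) *\<^sub>R S))) W = measure (gaussian_measure \<mu>1 ((s2 / ?\<alpha>\<^sup>2) *\<^sub>R S)) W"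
    unfolding \<mu>_def using s2
    by (intro gaussian_measure_scale_invariant[OF _ W inv] pd) simp_all
  moreover have "?\<alpha>\<^sup>2 *\<^sub>R ((s2 / ?\<alpha>\<^sup>2) *\<^sub>R S) = s2 *\<^sub>R S" by simp
  ultimately have "measure (gaussian_measure \<mu>1 ((s2 / ?\<alpha>\<^sup>2) *\<^sub>R S)) W < e'"
    using m \<open>e \<le> e'\<close> by simp
  moreover have "s2 / ?\<alpha>\<^sup>2 \<in> {0<..}" using s2 by simp
  ultimately show "\<exists>t2\<in>{0<..}. \<exists>S\<in>\<CC>. measure (gaussian_measure \<mu>1 (t2 *\<^sub>R S)) W < e'" using S by blast
qed simp

lemma almost_invariant_superlevel_set:
  assumes "almost_invariant G T"
  shows "almost_invariant_set G {y. c \<le> T y}"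
  unfolding almost_invariant_set_def almost_invariant_def
proof
  fix g assume "g \<in> G"
  then obtain N where N: "N \<in> sets borel" "emeasure lborel N = 0" "\<forall>g'\<in>G. emeasure lborel (g' -` N) = 0"
    and eq: "\<forall>y. y \<notin> N \<longrightarrow> T (g y) = T y"
    using assms unfolding almost_invariant_def by blast
  have "indicat_real {y. c \<le> T y} (g y) = indicat_real {y. c \<le> T y} y" if "y \<notin> N" for y
    using eq that by (simp add: indicator_def)
  with N show "\<exists>N\<in>sets borel. emeasure lborel N = 0 \<and> (\<forall>g'\<in>G. emeasure lborel (g' -` N) = 0) \<and>
      (\<forall>y. y \<notin> N \<longrightarrow> indicat_real {y. c \<le> T y} (g y) = indicat_real {y. c \<le> T y} y)"
    by blast
qed

theorem theorem5p7:
  fixes X :: "real^'k^'n" and R :: "real^'k^'q" and r :: "real^'q"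
    and \<CC> :: "(real^'n^'n) set" and W Z :: "(real^'n) set"
  assumes "CARD('k) < CARD('n)"
    and "rank X = CARD('k)"
    and "rank R = CARD('q)"
    and "covariance_model \<CC>"
    and "W \<in> sets borel"
    and "concentration_space \<CC> Z"
  shows
    "(\<forall>\<mu>0 \<in> null_means X R r.
        (emeasure (affine_lebesgue (translate \<mu>0 Z)) (frontier (W \<union> translate \<mu>0 Z)) = 0 \<longrightarrow>
           (\<forall>s2>0. (SUP S\<in>\<CC>. measure (gaussian_measure \<mu>0 (s2 *\<^sub>R S)) W) = 1) \<and>
           test_size X R r \<CC> W = 1) \<and>
        (\<forall>T :: real^'n \<Rightarrow> ereal. \<forall>c :: real.
           T \<in> borel_measurable borel \<and> 0 < c \<and> W = {y. T y \<ge> ereal c} \<and>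
           (AE z in affine_lebesgue Z. z \<in> Z \<longrightarrow> T (\<mu>0 + z) > ereal c \<and> lsc_at T (\<mu>0 + z)) \<longrightarrow>
           emeasure (affine_lebesgue (translate \<mu>0 Z)) (frontier (W \<union> translate \<mu>0 Z)) = 0))
     \<and>
     (\<forall>\<mu>0 \<in> null_means X R r.
        (emeasure (affine_lebesgue (translate \<mu>0 Z)) (frontier ((- W) \<union> translate \<mu>0 Z)) = 0 \<longrightarrow>
           (\<forall>s2>0. (INF S\<in>\<CC>. measure (gaussian_measure \<mu>0 (s2 *\<^sub>R S)) W) = 0) \<and>
           (\<forall>s2>0. (INF \<mu>1\<in>alt_means X R r. INF S\<in>\<CC>.
                      measure (gaussian_measure \<mu>1 (s2 *\<^sub>R S)) W) = 0) \<and>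
           (test_size X R r \<CC> W \<noteq> 0 \<longrightarrow> biased_test X R r \<CC> W)) \<and>
        (\<forall>T :: real^'n \<Rightarrow> ereal. \<forall>c :: real.
           T \<in> borel_measurable borel \<and> 0 < c \<and> W = {y. T y \<ge> ereal c} \<and>
           (AE z in affine_lebesgue Z. z \<in> Z \<longrightarrow> T (\<mu>0 + z) < ereal c \<and> usc_at T (\<mu>0 + z)) \<longrightarrow>
           emeasure (affine_lebesgue (translate \<mu>0 Z)) (frontier ((- W) \<union> translate \<mu>0 Z)) = 0))
     \<and>
     (\<forall>\<mu>0 \<in> null_means X R r.
        (\<forall>s2>0. (INF S\<in>\<CC>. measure (gaussian_measure \<mu>0 (s2 *\<^sub>R S)) W) = 0 \<and>
                almost_invariant_set (scale_group \<mu>0) W \<longrightarrow>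
           (\<forall>\<mu>1 \<in> alt_means X R r.
              (INF t2\<in>{0<..}. INF S\<in>\<CC>. measure (gaussian_measure \<mu>1 (t2 *\<^sub>R S)) W) = 0)) \<and>
        (\<forall>T :: real^'n \<Rightarrow> ereal. \<forall>c :: real.
           T \<in> borel_measurable borel \<and> 0 < c \<and> W = {y. T y \<ge> ereal c} \<and>
           almost_invariant (scale_group \<mu>0) T \<longrightarrow>
           almost_invariant_set (scale_group \<mu>0) W))"
proof -
  let ?P = "\<lambda>\<mu> s2 S. measure (gaussian_measure \<mu> (s2 *\<^sub>R S)) W"
  note model = \<open>covariance_model \<CC>\<close>
  note W = \<open>W \<in> sets borel\<close>
  note Z = \<open>concentration_space \<CC> Z\<close>
  have ne: "\<CC> \<noteq> {}" using model by (simp add: covariance_model_def)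
  have subZ: "subspace Z" using Z by (simp add: concentration_space_def)
  have prob: "prob_space (gaussian_measure \<mu> (s2 *\<^sub>R S))" if "0 < s2" "S \<in> \<CC>" for \<mu> s2 S
  proof (rule prob_space_gaussian_measure)
    have "sym_pos_def S" using model that(2) by (simp add: covariance_model_def)
    then show "sym_pos_def (s2 *\<^sub>R S)" using that(1) by (rule sym_pos_def_scaleR)
  qed
  then have le1: "?P \<mu> s2 S \<le> 1" if "0 < s2" "S \<in> \<CC>" for \<mu> s2 S
    using that by (simp add: prob_space.prob_le_1)
  have part1: "(\<forall>s2>0. (SUP S\<in>\<CC>. ?P \<mu>0 s2 S) = 1) \<and> test_size X R r \<CC> W = 1"
    if \<mu>0: "\<mu>0 \<in> null_means X R r"
      and null: "emeasure (affine_lebesgue (translate \<mu>0 Z)) (frontier (W \<union> translate \<mu>0 Z)) = 0" for \<mu>0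
  proof -
    have near1: "\<exists>S\<in>\<CC>. 1 - e < ?P \<mu>0 s2 S" if "0 < s2" "0 < e" for s2 e
      using concentration_space_power[OF model Z W null tendsto_const that] by blast
    have "test_size X R r \<CC> W = 1"
      unfolding test_size_def
    proof (rule real_SUP_eqI)
      fix e :: real assume "0 < e"
      then obtain S where "S \<in> \<CC>" "1 - e < ?P \<mu>0 1 S" using near1[of 1 e] by auto
      with \<mu>0 show "\<exists>x\<in>null_means X R r \<times> {0<..} \<times> \<CC>. 1 - e < (case x of (\<mu>, s2, S) \<Rightarrow> ?P \<mu> s2 S)"
        by (intro bexI[of _ "(\<mu>0, 1, S)"]) auto
    qed (use le1 in auto)
    then show ?thesis using near1 le1 by (auto intro!: real_SUP_eqI)
  qed
  have part2: "(\<forall>s2>0. (INF S\<in>\<CC>. ?P \<mu>0 s2 S) = 0) \<and>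
      (\<forall>s2>0. (INF \<mu>1\<in>alt_means X R r. INF S\<in>\<CC>. ?P \<mu>1 s2 S) = 0) \<and>
      (test_size X R r \<CC> W \<noteq> 0 \<longrightarrow> biased_test X R r \<CC> W)"
    if \<mu>0: "\<mu>0 \<in> null_means X R r"
      and null: "emeasure (affine_lebesgue (translate \<mu>0 Z)) (frontier (- W \<union> translate \<mu>0 Z)) = 0" for \<mu>0
  proof -
    have compl: "measure (gaussian_measure \<mu> (s2 *\<^sub>R S)) (- W) = 1 - ?P \<mu> s2 S" if "0 < s2" "S \<in> \<CC>" for \<mu> s2 S
      using prob_space.prob_compl[OF prob[OF that], of W] W by (simp add: Compl_eq_Diff_UNIV)
    have near0: "\<exists>m. \<exists>S\<in>\<CC>. ?P (\<mu> m) s2 S < e" if "\<mu> \<longlonglongrightarrow> \<mu>0" "0 < s2" "0 < e" for \<mu> s2 e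
    proof -
      note hyps = that
      obtain m S where S: "S \<in> \<CC>" and "1 - e < measure (gaussian_measure (\<mu> m) (s2 *\<^sub>R S)) (- W)"
        using concentration_space_power[OF model Z borel_comp[OF W] null hyps] by blast
      then have "?P (\<mu> m) s2 S < e" by (simp add: compl[OF hyps(2) S])
      with S show ?thesis by blast
    qed
    obtain \<mu>1 where \<mu>1: "\<mu>1 \<in> alt_means X R r"
      using alt_means_nonempty[OF assms(2,3)] by blast
    have near0_alt: "\<exists>\<mu>\<in>alt_means X R r. \<exists>S\<in>\<CC>. ?P \<mu> s2 S < e" if "0 < s2" "0 < e" for s2 e
    proof -
      note hyps = that
      obtain m S where "S \<in> \<CC>" "?P (\<mu>0 + (1 / real (Suc m)) *\<^sub>R (\<mu>1 - \<mu>0)) s2 S < e"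
        using near0[OF tendsto_contract hyps] by blast
      moreover have "\<mu>0 + (1 / real (Suc m)) *\<^sub>R (\<mu>1 - \<mu>0) \<in> alt_means X R r"
        by (rule alt_means_contract[OF assms(2) \<mu>0 \<mu>1]) simp
      ultimately show ?thesis by blast
    qed
    have inf_null: "(INF S\<in>\<CC>. ?P \<mu>0 s2 S) = 0" if "0 < s2" for s2
    proof (rule real_INF_eq_0I)
      show "\<exists>S\<in>\<CC>. ?P \<mu>0 s2 S < e" if "0 < e" for e
        using near0[OF tendsto_const \<open>0 < s2\<close> that] by blast
    qed simp
    have inf_alt: "(INF \<mu>1\<in>alt_means X R r. INF S\<in>\<CC>. ?P \<mu>1 s2 S) = 0" if "0 < s2" for s2
      by (rule real_INF_INF_eq_0I) (use near0_alt[OF that] ne in simp_all)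
    have "(INF (\<mu>, s2, S) \<in> alt_means X R r \<times> {0<..} \<times> \<CC>. ?P \<mu> s2 S) = 0"
    proof (rule real_INF_eq_0I)
      fix e :: real assume "0 < e"
      then obtain \<mu> S where "\<mu> \<in> alt_means X R r" "S \<in> \<CC>" "?P \<mu> 1 S < e" using near0_alt[of 1 e] by auto
      then show "\<exists>x\<in>alt_means X R r \<times> {0<..} \<times> \<CC>. (case x of (\<mu>, s2, S) \<Rightarrow> ?P \<mu> s2 S) < e"
        by (intro bexI[of _ "(\<mu>, 1, S)"]) auto
    qed auto
    moreover have "0 \<le> test_size X R r \<CC> W"
    proof -
      obtain S where "S \<in> \<CC>" using ne by blast
      then have "?P \<mu>0 1 S \<le> test_size X R r \<CC> W"
        unfolding test_size_def using \<mu>0 le1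
        by (intro cSUP_upper2[where x = "(\<mu>0, 1, S)"]) (auto simp: bdd_above_def)
      then show ?thesis by (rule order_trans[OF measure_nonneg])
    qed
    ultimately show ?thesis using inf_null inf_alt by (simp add: biased_test_def)
  qed
  \<comment> \<open>The two semicontinuity criteria are the same topological fact for \<open>W\<close> and for its complement.\<close>
  have lsc: "emeasure (affine_lebesgue (translate \<mu>0 Z)) (frontier (W \<union> translate \<mu>0 Z)) = 0"
    if WT: "W = {y. T y \<ge> ereal c}"
      and T: "AE z in affine_lebesgue Z. z \<in> Z \<longrightarrow> T (\<mu>0 + z) > ereal c \<and> lsc_at T (\<mu>0 + z)"
    for \<mu>0 and T :: "real^'n \<Rightarrow> ereal" and c :: real
  proof (rule frontier_null_if_interior_AE[OF subZ])
    show "AE z in affine_lebesgue Z. z \<in> Z \<longrightarrow> eventually (\<lambda>y. y \<in> W) (nhds (\<mu>0 + z))"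
      using T by eventually_elim (auto simp: lsc_at_def WT elim!: eventually_mono intro: less_imp_le)
  qed
  have usc: "emeasure (affine_lebesgue (translate \<mu>0 Z)) (frontier (- W \<union> translate \<mu>0 Z)) = 0"
    if WT: "W = {y. T y \<ge> ereal c}"
      and T: "AE z in affine_lebesgue Z. z \<in> Z \<longrightarrow> T (\<mu>0 + z) < ereal c \<and> usc_at T (\<mu>0 + z)"
    for \<mu>0 and T :: "real^'n \<Rightarrow> ereal" and c :: real
  proof (rule frontier_null_if_interior_AE[OF subZ])
    show "AE z in affine_lebesgue Z. z \<in> Z \<longrightarrow> eventually (\<lambda>y. y \<in> - W) (nhds (\<mu>0 + z))"
      using T by eventually_elim (auto simp: usc_at_def WT not_le elim!: eventually_mono)
  qed
  show ?thesis
  proof (intro conjI ballI)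
    fix \<mu>0 assume \<mu>0: "\<mu>0 \<in> null_means X R r"
    show "emeasure (affine_lebesgue (translate \<mu>0 Z)) (frontier (W \<union> translate \<mu>0 Z)) = 0 \<longrightarrow>
           (\<forall>s2>0. (SUP S\<in>\<CC>. measure (gaussian_measure \<mu>0 (s2 *\<^sub>R S)) W) = 1) \<and>
           test_size X R r \<CC> W = 1"
      using part1[OF \<mu>0] by blast
    show "emeasure (affine_lebesgue (translate \<mu>0 Z)) (frontier (- W \<union> translate \<mu>0 Z)) = 0 \<longrightarrow>
           (\<forall>s2>0. (INF S\<in>\<CC>. measure (gaussian_measure \<mu>0 (s2 *\<^sub>R S)) W) = 0) \<and>
           (\<forall>s2>0. (INF \<mu>1\<in>alt_means X R r. INF S\<in>\<CC>.
                      measure (gaussian_measure \<mu>1 (s2 *\<^sub>R S)) W) = 0) \<and>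
           (test_size X R r \<CC> W \<noteq> 0 \<longrightarrow> biased_test X R r \<CC> W)"
      using part2[OF \<mu>0] by blast
  qed (use lsc usc power_zero_at_alternative[OF model W] almost_invariant_superlevel_set in blast)+
qed

end
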